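(* Let $\alpha\ge 0$ be a real constant (linearised friction law, with frozen frictional strength $\alpha$). Let $\boldsymbol{\mathcal E}=(\boldsymbol{\mathcal E}^-,\boldsymbol{\mathcal E}^+)$ be the numerical error, a differentiable-in-time grid function satisfying in each of the two blocks the semi-discrete error equation $$\widetilde{\mathbf P}^{-1}\frac{d}{dt}\boldsymbol{\mathcal E}=\sum_{\xi\in\{q,r,s\}}(I_9\otimes\mathbf D_{-\xi})\mathbf F_\xi(\boldsymbol{\mathcal E})+\sum_{\xi\in\{q,r,s\}}\mathbf B_\xi(\nabla_{D_+}\boldsymbol{\mathcal E})+\mathbf{SAT}_q(\mathbf e_v-\widehat{\mathbf e}_v,\mathbf e_T-\widehat{\mathbf e}_T)+\boldsymbol{\mathbb T},$$ with truncation error $\boldsymbol{\mathbb T}=(\boldsymbol{\mathbb T}^-,\boldsymbol{\mathbb T}^+)$, where all operators, the penalty terms, and the error hat-variables are as defined in the context, and boundary contributions from all faces other than the fault are zero. Then $$\frac{d}{dt}\|\boldsymbol{\mathcal E}(t)\|_{HP}^2+\mathbb{BT}_s\le\|\boldsymbol{\mathcal E}(t)\|_{HP}\,\|\boldsymbol{\mathbb T}(t)\|_{HP^{-1}},$$ where $\mathbb{BT}_s=-\left(F_{luc}(\mathbf G^-,\mathbf Z^-)+F_{luc}(\mathbf G^+,\mathbf Z^+)+\mathbb{IT}_s\right)\ge 0$ with $$F_{luc}(\mathbf G^\pm,\mathbf Z^\pm)=-\mathbb I_q\left(\sum_{j\in\{l,m,n\}}\frac{1}{Z_j^\pm}|G_j^\pm|^2\right)\le0,\qquad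 \mathbb{IT}_s=-\mathbb I_q\left(\alpha|\widehat V_e|^2\right)\le 0,\qquad |\widehat V_e|^2=[\![\widehat e_{vl}]\!]^2+[\![\widehat e_{vm}]\!]^2 .$$
   Context: **Geometry.** Two elastic blocks $\Omega^-,\Omega^+$ share a fault interface. Each block is the image of the unit cube $[0,1]^3$ with coordinates $(q,r,s)$ under a smooth invertible map to $(x,y,z)$ with Jacobian determinant $J>0$; $\xi_x,\xi_y,\xi_z$ denote the partial derivatives of $\xi\in\{q,r,s\}$ with respect to $x,y,z$. The fault is the face $q=1$ of the $-$ block and the face $q=0$ of the $+$ block; the two parametrizations (and grids) agree there, so the unit normal $\mathbf n=(n_x,n_y,n_z)^T=(q_x,q_y,q_z)^T/|\mathbf q_\xi|$, $|\mathbf q_\xi|=\sqrt{q_x^2+q_y^2+q_z^2}$, and the factor $J|\mathbf q_\xi|$ are the same from both sides. **Fields.** At every grid point of each block, a field has 9 components $\mathbf Q=(v_x,v_y,v_z,\sigma_{xx},\sigma_{yy},\sigma_{zz},\sigma_{xy},\sigma_{xz},\sigma_{yz})^T$. $\widetilde{\mathbf P}^{-1}=J\mathbf P^{-1}$ with $\mathbf P=\mathrm{diag}(\rho^{-1}I_3,\mathbf C)$, $\rho>0$ the density, $\mathbf C$ the symmetric positive definite $6\times6$ stiffness matrix (both time-independent, possibly varying in space and between blocks). Pointwise, $\mathbf F_\xi(\mathbf Q)=\big(J(\xi_x\sigma_{xx}+\xi_y\sigma_{xy}+\xi_z\sigma_{xz}),\,J(\xi_x\sigma_{xy}+\xi_y\sigma_{yy}+\xi_z\sigma_{yz}),\,J(\xi_x\sigma_{xz}+\xi_y\sigma_{yz}+\xi_z\sigma_{zz}),0,0,0,0,0,0\big)^T$,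 and $\mathbf B_\xi(\nabla_{D_+}\mathbf Q)=J\big(0,0,0,\ \xi_xd_x,\ \xi_yd_y,\ \xi_zd_z,\ \xi_yd_x+\xi_xd_y,\ \xi_zd_x+\xi_xd_z,\ \xi_zd_y+\xi_yd_z\big)^T$ with $d_a=\mathbf D_{+\xi}v_a$ for $a\in\{x,y,z\}$. The error $\boldsymbol{\mathcal E}$ is the difference between the numerical solution and the restriction of the exact solution to the grid; $\boldsymbol{\mathbb T}$ is the residual arising from inserting the restricted exact solution in the scheme. For the claim, only the error equation is used. **Dual-pairing (DP) SBP operators.** For each $\xi\in\{q,r,s\}$ the grid is $\xi_i=i/n_\xi$, $i=0,\dots,n_\xi$. $H_\xi=\mathrm{diag}(h_0^{(\xi)},\dots,h_{n_\xi}^{(\xi)})$ with all $h_i^{(\xi)}>0$, and $D_{+\xi},D_{-\xi}$ are linear maps on $\mathbb R^{n_\xi+1}$ with $(D_{+\xi}\mathbf f)^TH_\xi\mathbf g+\mathbf f^TH_\xi(D_{-\xi}\mathbf g)=f_{n_\xi}g_{n_\xi}-f_0g_0$ for all $\mathbf f,\mathbf g$. $\mathbf D_{\pm\xi}$ is the tensor-product extension to 3D grid functions acting in direction $\xi$ (identity in the other directions), and $\mathbf H=H_q\otimes H_r\otimes H_s$. The inner product is $\langle\mathbf g,\mathbf f\rangle_{\mathbf H}=\mathbf g^T\mathbf H\mathbf f$ (summed over the 9 components for vector fields). The energy norm is $\|\mathbf Q\|_{HP}^2=\langle\mathbf Q,\tfrac12\widetilde{\mathbf P}^{-1}\mathbf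 Q\rangle_{\mathbf H}$ and $\|\mathbf Q\|_{HP^{-1}}^2=\langle\mathbf Q,(\tfrac12\widetilde{\mathbf P}^{-1})^{-1}\mathbf Q\rangle_{\mathbf H}$ is the corresponding dual norm; for pairs, $\|\boldsymbol{\mathcal E}\|^2=\|\boldsymbol{\mathcal E}^-\|^2+\|\boldsymbol{\mathcal E}^+\|^2$ in either norm. For a grid function $g_{jk}$ on the fault, $\mathbb I_q(g)=\sum_{j=0}^{n_r}\sum_{k=0}^{n_s}J_{jk}|\mathbf q_\xi|_{jk}\,g_{jk}\,h_j^{(r)}h_k^{(s)}$. **Error interface variables.** At each fault grid point, $\mathbf e_v^\pm$ is the velocity part of $\boldsymbol{\mathcal E}^\pm$ and $\mathbf e_T^\pm=\bar{\bar\sigma}\mathbf n$ with $\bar{\bar\sigma}$ the symmetric $3\times3$ matrix formed from the stress part of $\boldsymbol{\mathcal E}^\pm$, both taken at the fault face of the block. With a local orthonormal basis $\mathbf n,\mathbf m,\mathbf l$ and $\mathbf R$ the matrix with rows $\mathbf n^T,\mathbf m^T,\mathbf l^T$, let $(e_{vn}^\pm,e_{vm}^\pm,e_{vl}^\pm)^T=\mathbf R\mathbf e_v^\pm$, $(e_{Tn}^\pm,e_{Tm}^\pm,e_{Tl}^\pm)^T=\mathbf R\mathbf e_T^\pm$. Given $Z_j^\pm>0$, the error hat-variables $\widehat e_{vj}^\pm$, $\widehat e_{Tj}^\pm=\widehat e_{Tj}$ are determined by the linearised interface conditions: $Z_j^+\widehat e_{vj}^++\widehat e_{Tj}=Z_j^+e_{vj}^++e_{Tj}^+$;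 $Z_j^-\widehat e_{vj}^--\widehat e_{Tj}=Z_j^-e_{vj}^--e_{Tj}^-$ $(j\in\{l,m,n\})$; $[\![\widehat e_{vn}]\!]=0$; $\widehat e_{Tj}=\alpha[\![\widehat e_{vj}]\!]$ $(j\in\{l,m\})$, where $[\![\widehat e_{vj}]\!]=\widehat e_{vj}^+-\widehat e_{vj}^-$. **Penalty terms.** $G_j^+=\tfrac12Z_j^+(e_{vj}^+-\widehat e_{vj}^+)-\tfrac12(e_{Tj}^+-\widehat e_{Tj}^+)$, $G_j^-=\tfrac12Z_j^-(e_{vj}^--\widehat e_{vj}^-)+\tfrac12(e_{Tj}^--\widehat e_{Tj}^-)$, $\widetilde G_j^\pm=G_j^\pm/Z_j^\pm$; $(G_x,G_y,G_z)^T=\mathbf R^T(G_n,G_m,G_l)^T$ and likewise for $\widetilde G$. Let $\mathbf{SAT}^{\pm}=\big(G_x,G_y,G_z,\ \mp n_x\widetilde G_x,\ \mp n_y\widetilde G_y,\ \mp n_z\widetilde G_z,\ \mp(n_y\widetilde G_x+n_x\widetilde G_y),\ \mp(n_z\widetilde G_x+n_x\widetilde G_z),\ \mp(n_z\widetilde G_y+n_y\widetilde G_z)\big)^T$ with all $G,\widetilde G$ carrying the superscript $\pm$. In the $-$ block $\mathbf{SAT}_q$ is the grid function supported on the face $i=n_q$ with value $-\frac{1}{h_{n_q}^{(q)}}J|\mathbf q_\xi|\,\mathbf{SAT}^-$ there, and in the $+$ block it is supported on the face $i=0$ with value $-\frac{1}{h_0^{(q)}}J|\mathbf q_\xi|\,\mathbf{SAT}^+$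 there. **Other boundaries.** When SBP is applied in the expansion of $\langle\boldsymbol{\mathcal E},\sum_\xi(I_9\otimes\mathbf D_{-\xi})\mathbf F_\xi(\boldsymbol{\mathcal E})\rangle_{\mathbf H}$, the discrete boundary terms $\boldsymbol{\mathcal E}^T\mathbf F_\xi(\boldsymbol{\mathcal E})$, summed with the quadrature weights over each face other than the fault, are assumed to be zero. *)

theory Defs
  imports "HOL-Analysis.Analysis"
begin

text \<open>
  The index type 3 serves three purposes: the parameter directions q, r, s are 1, 2, 3; the
  Cartesian directions x, y, z are 1, 2, 3; the local fault directions n, m, l are 1, 2, 3.
  A field value is a pair of the velocity (x, y, z) and the stress in the order
  (xx, yy, zz, xy, xz, yz); the inner product of the product type is the sum over the nine
  components.  A grid function is total on triples of naturals, but only its values on the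
  grid \<open>{..n_q} \<times> {..n_r} \<times> {..n_s}\<close> enter.
\<close>

type_synonym field9 = "(real^3) \<times> (real^6)"
type_synonym 'a grid = "nat \<Rightarrow> nat \<Rightarrow> nat \<Rightarrow> 'a"

record sbp =
  npts :: nat                        \<comment> \<open>the grid is \<open>i / npts\<close> for \<open>i = 0, \<dots>, npts\<close>\<close>
  wt :: "nat \<Rightarrow> real"                \<comment> \<open>diagonal of \<open>H\<close>\<close>
  Dplus :: "nat \<Rightarrow> nat \<Rightarrow> real"      \<comment> \<open>matrix entries (row, column)\<close>
  Dminus :: "nat \<Rightarrow> nat \<Rightarrow> real"

definition dp_sbp :: "sbp \<Rightarrow> bool" where
  "dp_sbp S \<longleftrightarrow> 1 \<le> npts S \<and> (\<forall>i\<le>npts S. 0 < wt S i) \<and>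
     (\<forall>f g :: nat \<Rightarrow> real.
        (\<Sum>i\<le>npts S. (\<Sum>k\<le>npts S. Dplus S i k * f k) * wt S i * g i)
        + (\<Sum>i\<le>npts S. f i * wt S i * (\<Sum>k\<le>npts S. Dminus S i k * g k))
        = f (npts S) * g (npts S) - f 0 * g 0)"

text \<open>
  \<open>Ck_on k U f\<close> is meant for open \<open>U\<close>, where it says that \<open>f\<close> is \<open>k\<close> times continuously
  differentiable: all iterated directional derivatives up to order \<open>k\<close> exist and are continuous.
\<close>

primrec Ck_on :: "nat \<Rightarrow> (real^3) set \<Rightarrow> (real^3 \<Rightarrow> real^3) \<Rightarrow> bool" where
  "Ck_on 0 U f \<longleftrightarrow> continuous_on U f"
| "Ck_on (Suc k) U f \<longleftrightarrow> (\<forall>x\<in>U. f differentiable (at x)) \<and>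
     (\<forall>v. Ck_on k U (\<lambda>x. frechet_derivative f (at x) v))"

definition smooth_on :: "(real^3) set \<Rightarrow> (real^3 \<Rightarrow> real^3) \<Rightarrow> bool" where
  "smooth_on U f \<longleftrightarrow> (\<forall>k. Ck_on k U f)"

definition unit_cube :: "(real^3) set" where
  "unit_cube = {p. \<forall>i. 0 \<le> p $ i \<and> p $ i \<le> 1}"

record block =
  bmap :: "real^3 \<Rightarrow> real^3"         \<comment> \<open>(q, r, s) to (x, y, z)\<close>
  bcoord :: "real^3 \<Rightarrow> real^3"       \<comment> \<open>(x, y, z) to (q, r, s)\<close>
  rho :: "real^3 \<Rightarrow> real"            \<comment> \<open>function of (x, y, z)\<close>
  stiff :: "real^3 \<Rightarrow> real^6^6"      \<comment> \<open>function of (x, y, z)\<close>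
  op1 :: "3 \<Rightarrow> sbp"

definition jac :: "block \<Rightarrow> real^3 \<Rightarrow> real" where
  "jac b p = det (matrix (frechet_derivative (bmap b) (at p)))"

text \<open>The gradient in (x, y, z) of the parameter coordinate \<open>\<xi>\<close>,
  taken at the point with parameters \<open>p\<close>.\<close>

definition grad_coord :: "block \<Rightarrow> 3 \<Rightarrow> real^3 \<Rightarrow> real^3" where
  "grad_coord b \<xi> p =
     (\<chi> a. frechet_derivative (bcoord b) (at (bmap b p)) (axis a 1) $ \<xi>)"

text \<open>
  A smooth invertible map on the closed cube is one that extends to a diffeomorphism between
  open neighbourhoods of the cube and of the block, so that all derivatives make sense up to
  the boundary.
\<close>

definition valid_block :: "block \<Rightarrow> bool" where
  "valid_block b \<longleftrightarrow>
     (\<exists>U V. open U \<and> open V \<and> unit_cube \<subseteq> U \<and> bmap b ` U = V \<and>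
        (\<forall>p\<in>U. bcoord b (bmap b p) = p) \<and>
        smooth_on U (bmap b) \<and> smooth_on V (bcoord b)) \<and>
     (\<forall>p\<in>unit_cube. 0 < jac b p) \<and>
     (\<forall>x\<in>bmap b ` unit_cube. 0 < rho b x) \<and>
     (\<forall>x\<in>bmap b ` unit_cube. transpose (stiff b x) = stiff b x \<and>
        (\<forall>w. w \<noteq> 0 \<longrightarrow> 0 < w \<bullet> (stiff b x *v w))) \<and>
     (\<forall>\<xi>. dp_sbp (op1 b \<xi>))"

abbreviation nn :: "block \<Rightarrow> 3 \<Rightarrow> nat" where "nn b \<xi> \<equiv> npts (op1 b \<xi>)"
abbreviation hh :: "block \<Rightarrow> 3 \<Rightarrow> nat \<Rightarrow> real" where "hh b \<xi> \<equiv> wt (op1 b \<xi>)"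

definition gpt :: "block \<Rightarrow> nat \<Rightarrow> nat \<Rightarrow> nat \<Rightarrow> real^3" where
  "gpt b i j k = vector [real i / real (nn b 1), real j / real (nn b 2), real k / real (nn b 3)]"

definition ext_op :: "block \<Rightarrow> (sbp \<Rightarrow> nat \<Rightarrow> nat \<Rightarrow> real) \<Rightarrow> 3 \<Rightarrow>
    'a::real_vector grid \<Rightarrow> 'a grid" where
  "ext_op b D \<xi> f i j k =
     (if \<xi> = 1 then \<Sum>m\<le>nn b 1. D (op1 b 1) i m *\<^sub>R f m j k
      else if \<xi> = 2 then \<Sum>m\<le>nn b 2. D (op1 b 2) j m *\<^sub>R f i m k
      else \<Sum>m\<le>nn b 3. D (op1 b 3) k m *\<^sub>R f i j m)"

definition inner_H :: "block \<Rightarrow> field9 grid \<Rightarrow> field9 grid \<Rightarrow> real" where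
  "inner_H b Q W = (\<Sum>i\<le>nn b 1. \<Sum>j\<le>nn b 2. \<Sum>k\<le>nn b 3.
     hh b 1 i * hh b 2 j * hh b 3 k * (Q i j k \<bullet> W i j k))"

definition P_mat :: "block \<Rightarrow> real^3 \<Rightarrow> field9 \<Rightarrow> field9" where
  "P_mat b p Q = ((1 / rho b (bmap b p)) *\<^sub>R fst Q, stiff b (bmap b p) *v snd Q)"

definition Ptilde_inv :: "block \<Rightarrow> real^3 \<Rightarrow> field9 \<Rightarrow> field9" where
  "Ptilde_inv b p Q = jac b p *\<^sub>R inv (P_mat b p) Q"

definition half_Ptilde_inv :: "block \<Rightarrow> real^3 \<Rightarrow> field9 \<Rightarrow> field9" where
  "half_Ptilde_inv b p Q = (1/2) *\<^sub>R Ptilde_inv b p Q"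

definition hp_sq :: "block \<Rightarrow> field9 grid \<Rightarrow> real" where
  "hp_sq b Q = inner_H b Q (\<lambda>i j k. half_Ptilde_inv b (gpt b i j k) (Q i j k))"

definition hpinv_sq :: "block \<Rightarrow> field9 grid \<Rightarrow> real" where
  "hpinv_sq b Q = inner_H b Q (\<lambda>i j k. inv (half_Ptilde_inv b (gpt b i j k)) (Q i j k))"

definition hp_norm2 :: "block \<Rightarrow> block \<Rightarrow> field9 grid \<Rightarrow> field9 grid \<Rightarrow> real" where
  "hp_norm2 bm bp Qm Qp = sqrt (hp_sq bm Qm + hp_sq bp Qp)"

definition hpinv_norm2 :: "block \<Rightarrow> block \<Rightarrow> field9 grid \<Rightarrow> field9 grid \<Rightarrow> real" where
  "hpinv_norm2 bm bp Qm Qp = sqrt (hpinv_sq bm Qm + hpinv_sq bp Qp)"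

definition stress_mat :: "real^6 \<Rightarrow> real^3^3" where
  "stress_mat \<sigma> = vector [vector [\<sigma>$1, \<sigma>$4, \<sigma>$5],
                          vector [\<sigma>$4, \<sigma>$2, \<sigma>$6],
                          vector [\<sigma>$5, \<sigma>$6, \<sigma>$3]]"

definition flux_F :: "block \<Rightarrow> 3 \<Rightarrow> real^3 \<Rightarrow> field9 \<Rightarrow> field9" where
  "flux_F b \<xi> p Q = (let J = jac b p; g = grad_coord b \<xi> p; \<sigma> = snd Q in
     (vector [J * (g$1 * \<sigma>$1 + g$2 * \<sigma>$4 + g$3 * \<sigma>$5),
              J * (g$1 * \<sigma>$4 + g$2 * \<sigma>$2 + g$3 * \<sigma>$6),
              J * (g$1 * \<sigma>$5 + g$2 * \<sigma>$6 + g$3 * \<sigma>$3)], 0))"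

text \<open>The Voigt vector of the symmetrised product of two vectors, with doubled shear entries.\<close>

definition voigt :: "real^3 \<Rightarrow> real^3 \<Rightarrow> real^6" where
  "voigt g d = vector [g$1 * d$1, g$2 * d$2, g$3 * d$3,
     g$2 * d$1 + g$1 * d$2, g$3 * d$1 + g$1 * d$3, g$3 * d$2 + g$2 * d$3]"

definition ncp_B :: "block \<Rightarrow> 3 \<Rightarrow> real^3 \<Rightarrow> real^3 \<Rightarrow> field9" where
  "ncp_B b \<xi> p d = jac b p *\<^sub>R (0, voigt (grad_coord b \<xi> p) d)"

definition spatial_rhs :: "block \<Rightarrow> field9 grid \<Rightarrow> field9 grid" where
  "spatial_rhs b Q i j k =
     (\<Sum>\<xi>\<in>UNIV. ext_op b Dminus \<xi> (\<lambda>i j k. flux_F b \<xi> (gpt b i j k) (Q i j k)) i j k)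
   + (\<Sum>\<xi>\<in>UNIV. ncp_B b \<xi> (gpt b i j k) (ext_op b Dplus \<xi> (\<lambda>i j k. fst (Q i j k)) i j k))"

text \<open>The boundary term of direction \<open>\<xi>\<close>, summed over the grid plane with index \<open>a\<close> in that
  direction.\<close>

definition face_term :: "block \<Rightarrow> 3 \<Rightarrow> nat \<Rightarrow> field9 grid \<Rightarrow> real" where
  "face_term b \<xi> a Q =
    (let t = (\<lambda>i j k. Q i j k \<bullet> flux_F b \<xi> (gpt b i j k) (Q i j k)) in
     if \<xi> = 1 then \<Sum>j\<le>nn b 2. \<Sum>k\<le>nn b 3. hh b 2 j * hh b 3 k * t a j k
     else if \<xi> = 2 then \<Sum>i\<le>nn b 1. \<Sum>k\<le>nn b 3. hh b 1 i * hh b 3 k * t i a k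
     else \<Sum>i\<le>nn b 1. \<Sum>j\<le>nn b 2. hh b 1 i * hh b 2 j * t i j a)"

text \<open>
  The fault is the face \<open>q = 1\<close> of the minus block \<open>bm\<close> and the face \<open>q = 0\<close> of the plus block
  \<open>bp\<close>.  Parametrizations, grids and quadrature weights agree there; nothing is required of the
  two operator pairs away from the fault.  Since the cofactors \<open>J q\<^sub>x, J q\<^sub>y, J q\<^sub>z\<close> depend on the
  tangential derivatives only, the quantities \<open>fault_normal\<close> and \<open>fault_fac\<close> below, which are
  computed in the minus block, are the same when computed in the plus block.
\<close>

definition shared_fault :: "block \<Rightarrow> block \<Rightarrow> bool" where
  "shared_fault bm bp \<longleftrightarrow>
     (\<forall>r\<in>{0..1}. \<forall>s\<in>{0..1}. bmap bm (vector [1, r, s]) = bmap bp (vector [0, r, s])) \<and>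
     (\<forall>\<xi>\<in>{2, 3}. nn bm \<xi> = nn bp \<xi> \<and> (\<forall>j\<le>nn bm \<xi>. hh bm \<xi> j = hh bp \<xi> j))"

definition fault_grad :: "block \<Rightarrow> nat \<Rightarrow> nat \<Rightarrow> real^3" where
  "fault_grad bm j k = grad_coord bm 1 (gpt bm (nn bm 1) j k)"

definition fault_normal :: "block \<Rightarrow> nat \<Rightarrow> nat \<Rightarrow> real^3" where
  "fault_normal bm j k = (1 / norm (fault_grad bm j k)) *\<^sub>R fault_grad bm j k"

definition fault_fac :: "block \<Rightarrow> nat \<Rightarrow> nat \<Rightarrow> real" where
  "fault_fac bm j k = jac bm (gpt bm (nn bm 1) j k) * norm (fault_grad bm j k)"

definition fault_int :: "block \<Rightarrow> (nat \<Rightarrow> nat \<Rightarrow> real) \<Rightarrow> real" where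
  "fault_int bm g = (\<Sum>j\<le>nn bm 2. \<Sum>k\<le>nn bm 3. fault_fac bm j k * g j k * hh bm 2 j * hh bm 3 k)"

definition orthonormal3 :: "real^3 \<Rightarrow> real^3 \<Rightarrow> real^3 \<Rightarrow> bool" where
  "orthonormal3 n m l \<longleftrightarrow> norm n = 1 \<and> norm m = 1 \<and> norm l = 1 \<and>
     n \<bullet> m = 0 \<and> n \<bullet> l = 0 \<and> m \<bullet> l = 0"

definition rot :: "real^3 \<Rightarrow> real^3 \<Rightarrow> real^3 \<Rightarrow> real^3^3" where
  "rot n m l = vector [n, m, l]"

definition local_v :: "real^3^3 \<Rightarrow> field9 \<Rightarrow> real^3" where
  "local_v R Q = R *v fst Q"

definition local_T :: "real^3^3 \<Rightarrow> real^3 \<Rightarrow> field9 \<Rightarrow> real^3" where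
  "local_T R n Q = R *v (stress_mat (snd Q) *v n)"

text \<open>The linearised interface conditions at one fault point, in the local components
  n, m, l = 1, 2, 3, for given velocities and tractions and for the hat-variables
  \<open>wm\<close>, \<open>wp\<close> (velocities) and \<open>S\<close> (the common traction).\<close>

definition hat_conditions :: "real \<Rightarrow> real^3 \<Rightarrow> real^3 \<Rightarrow> real^3 \<Rightarrow> real^3 \<Rightarrow> real^3 \<Rightarrow> real^3 \<Rightarrow>
    real^3 \<Rightarrow> real^3 \<Rightarrow> real^3 \<Rightarrow> bool" where
  "hat_conditions \<alpha> Zm Zp vm Tm vp Tp wm wp S \<longleftrightarrow>
     (\<forall>j. Zp$j * wp$j + S$j = Zp$j * vp$j + Tp$j) \<and>
     (\<forall>j. Zm$j * wm$j - S$j = Zm$j * vm$j - Tm$j) \<and>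
     wp$1 - wm$1 = 0 \<and>
     (\<forall>j\<in>{2, 3}. S$j = \<alpha> * (wp$j - wm$j))"

text \<open>Below, \<open>\<epsilon>\<close> is \<open>1\<close> for the plus side and \<open>-1\<close> for the minus side.\<close>

definition penalty_G :: "real \<Rightarrow> real^3 \<Rightarrow> real^3 \<Rightarrow> real^3 \<Rightarrow> real^3 \<Rightarrow> real^3 \<Rightarrow> real^3" where
  "penalty_G \<epsilon> Z v w T S =
     (\<chi> j. 1/2 * Z$j * (v$j - w$j) - \<epsilon> * (1/2 * (T$j - S$j)))"

definition sat_val :: "real \<Rightarrow> real^3^3 \<Rightarrow> real^3 \<Rightarrow> real^3 \<Rightarrow> real^3 \<Rightarrow> field9" where
  "sat_val \<epsilon> R n Z G =
     (transpose R *v G, - \<epsilon> *\<^sub>R voigt n (transpose R *v (\<chi> j. G$j / Z$j)))"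

definition sat_minus :: "block \<Rightarrow> (nat \<Rightarrow> nat \<Rightarrow> field9) \<Rightarrow> field9 grid" where
  "sat_minus bm S i j k =
     (if i = nn bm 1 then - (1 / hh bm 1 (nn bm 1) * fault_fac bm j k) *\<^sub>R S j k else 0)"

definition sat_plus :: "block \<Rightarrow> block \<Rightarrow> (nat \<Rightarrow> nat \<Rightarrow> field9) \<Rightarrow> field9 grid" where
  "sat_plus bm bp S i j k =
     (if i = 0 then - (1 / hh bp 1 0 * fault_fac bm j k) *\<^sub>R S j k else 0)"

definition F_luc :: "block \<Rightarrow> (nat \<Rightarrow> nat \<Rightarrow> real^3) \<Rightarrow> (nat \<Rightarrow> nat \<Rightarrow> real^3) \<Rightarrow> real" where
  "F_luc bm G Z = - fault_int bm (\<lambda>j k. \<Sum>c\<in>UNIV. 1 / Z j k $ c * \<bar>G j k $ c\<bar>\<^sup>2)"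

definition IT_s :: "block \<Rightarrow> real \<Rightarrow> (nat \<Rightarrow> nat \<Rightarrow> real^3) \<Rightarrow> (nat \<Rightarrow> nat \<Rightarrow> real^3) \<Rightarrow> real" where
  "IT_s bm \<alpha> wm wp = - fault_int bm (\<lambda>j k.
     \<alpha> * ((wp j k $ 3 - wm j k $ 3)\<^sup>2 + (wp j k $ 2 - wm j k $ 2)\<^sup>2))"

end

theory Submission
  imports Defs
begin

text \<open>
  The weight matrix is symmetric, so the energy grows at the rate \<open>\<langle>E, J P\<^sup>-\<^sup>1
  E'\<rangle>\<close>, in which the error equation is substituted. Since \<open>B\<close> is the pointwise
  adjoint of \<open>F\<close>, dual-pairing summation by parts cancels all volume terms and leaves the power
  \<open>v \<cdot> T\<close> on the fault; the factor \<open>J |q\<^sub>\<xi>| n\<close> there is the cross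
  product of the tangent vectors of the fault, hence common to both blocks. At a fault point the hat conditions
  give \<open>G = T - S\<close> on the minus side and \<open>G = S - T\<close> on the plus side, so in each
  local component the power plus the penalty equals \<open>w S - G\<^sup>2 / Z\<close> on the minus side and
  \<open>- w S - G\<^sup>2 / Z\<close> on the plus side. The jump of \<open>w S\<close> vanishes in the normal
  direction and is \<open>\<alpha>\<close> times the squared velocity jump in the tangential ones. The pairing
  of the error with the truncation error is bounded by Cauchy-Schwarz for the pair of dual norms.
\<close>

subsection \<open>Stress, Voigt vectors and fluxes\<close>

lemma exhaust_6:
  fixes x :: 6
  shows "x = 1 \<or> x = 2 \<or> x = 3 \<or> x = 4 \<or> x = 5 \<or> x = 6"
proof (induct x)
  case (of_int z)
  then have "z = 0 \<or> z = 1 \<or> z = 2 \<or> z = 3 \<or> z = 4 \<or> z = 5" by fastforce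
  then show ?case by auto
qed

lemma UNIV_6: "UNIV = {1, 2, 3, 4, 5, 6::6}"
  using exhaust_6 by auto

lemma sum_6: "sum f (UNIV::6 set) = f 1 + f 2 + f 3 + f 4 + f 5 + f 6"
  unfolding UNIV_6 by (simp add: ac_simps)

lemma vector_6:
  "(vector [a, b, c, d, e, f] :: real^6) $ 1 = a"
  "(vector [a, b, c, d, e, f] :: real^6) $ 2 = b"
  "(vector [a, b, c, d, e, f] :: real^6) $ 3 = c"
  "(vector [a, b, c, d, e, f] :: real^6) $ 4 = d"
  "(vector [a, b, c, d, e, f] :: real^6) $ 5 = e"
  "(vector [a, b, c, d, e, f] :: real^6) $ 6 = f"
  unfolding vector_def by simp_all

text \<open>The doubled shear entries of \<open>voigt\<close> account for each off-diagonal stress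
  occurring twice in the symmetric bilinear form of \<open>stress_mat\<close>.\<close>

lemma inner_voigt: "\<sigma> \<bullet> voigt g d = (stress_mat \<sigma> *v g) \<bullet> d"
  by (simp add: voigt_def stress_mat_def inner_vec_def matrix_vector_mult_def sum_3 sum_6 vector_6
      algebra_simps)

lemma flux_F_eq:
  "flux_F b \<xi> p Q = (jac b p *\<^sub>R (stress_mat (snd Q) *v grad_coord b \<xi> p), 0)"
  by (simp add: flux_F_def Let_def stress_mat_def vec_eq_iff forall_3 matrix_vector_mult_def sum_3
      algebra_simps)

text \<open>Both sides are the bilinear form of the stress matrix at \<open>J\<close> times the
  gradient and \<open>d\<close>, so each \<open>Dplus\<close> term is a derivative paired with a
  flux.\<close>

lemma inner_ncp_B: "Q \<bullet> ncp_B b \<xi> p d = d \<bullet> fst (flux_F b \<xi> p Q)"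
  by (simp add: ncp_B_def flux_F_eq inner_prod_def inner_voigt inner_commute)

subsection \<open>Summation by parts\<close>

text \<open>The scalar identity in \<open>dp_sbp\<close> is applied to the coordinates along
  \<open>Basis\<close> and summed, so that it serves vector-valued velocities and fluxes.\<close>

lemma dp_sbp_inner:
  fixes f g :: "nat \<Rightarrow> 'a::euclidean_space"
  assumes "dp_sbp S"
  shows "(\<Sum>i\<le>npts S. wt S i * (f i \<bullet> (\<Sum>k\<le>npts S. Dminus S i k *\<^sub>R g k)
            + (\<Sum>k\<le>npts S. Dplus S i k *\<^sub>R f k) \<bullet> g i))
    = f (npts S) \<bullet> g (npts S) - f 0 \<bullet> g 0"
proof -
  let ?N = "npts S"
  have minus: "f i \<bullet> (\<Sum>k\<le>?N. Dminus S i k *\<^sub>R g k)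
      = (\<Sum>e\<in>Basis. (f i \<bullet> e) * (\<Sum>k\<le>?N. Dminus S i k * (g k \<bullet> e)))" for i
    by (subst euclidean_inner) (simp add: inner_sum_left)
  have plus: "(\<Sum>k\<le>?N. Dplus S i k *\<^sub>R f k) \<bullet> g i
      = (\<Sum>e\<in>Basis. (\<Sum>k\<le>?N. Dplus S i k * (f k \<bullet> e)) * (g i \<bullet> e))" for i
    by (subst euclidean_inner) (simp add: inner_sum_left)
  have "(\<Sum>i\<le>?N. wt S i * (f i \<bullet> (\<Sum>k\<le>?N. Dminus S i k *\<^sub>R g k)
            + (\<Sum>k\<le>?N. Dplus S i k *\<^sub>R f k) \<bullet> g i))
    = (\<Sum>i\<le>?N. \<Sum>e\<in>Basis. (\<Sum>k\<le>?N. Dplus S i k * (f k \<bullet> e)) * wt S i * (g i \<bullet> e)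
          + (f i \<bullet> e) * wt S i * (\<Sum>k\<le>?N. Dminus S i k * (g k \<bullet> e)))"
    unfolding minus plus by (simp add: sum.distrib sum_distrib_left distrib_left mult_ac)
  also have "\<dots> = (\<Sum>e\<in>Basis. (\<Sum>i\<le>?N. (\<Sum>k\<le>?N. Dplus S i k * (f k \<bullet> e)) * wt S i * (g i \<bullet> e))
          + (\<Sum>i\<le>?N. (f i \<bullet> e) * wt S i * (\<Sum>k\<le>?N. Dminus S i k * (g k \<bullet> e))))"
    by (subst sum.swap) (simp add: sum.distrib)
  also have "\<dots> = (\<Sum>e\<in>Basis. (f ?N \<bullet> e) * (g ?N \<bullet> e) - (f 0 \<bullet> e) * (g 0 \<bullet> e))"
    using assms by (intro sum.cong refl) (simp add: dp_sbp_def)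
  also have "\<dots> = f ?N \<bullet> g ?N - f 0 \<bullet> g 0"
    by (simp only: sum_subtractf euclidean_inner[of "f ?N" "g ?N"] euclidean_inner[of "f 0" "g 0"])
  finally show ?thesis .
qed

text \<open>The scalar quadrature behind \<open>inner_H\<close>, kept separate so that integrands
  can be combined pointwise.\<close>

definition grid_sum :: "block \<Rightarrow> real grid \<Rightarrow> real" where
  "grid_sum b f = (\<Sum>i\<le>nn b 1. \<Sum>j\<le>nn b 2. \<Sum>k\<le>nn b 3. hh b 1 i * hh b 2 j * hh b 3 k * f i j k)"

lemma inner_H_eq: "inner_H b Q W = grid_sum b (\<lambda>i j k. Q i j k \<bullet> W i j k)"
  by (simp add: inner_H_def grid_sum_def)

lemma grid_sum_cong:
  assumes "\<And>i j k. i \<le> nn b 1 \<Longrightarrow> j \<le> nn b 2 \<Longrightarrow> k \<le> nn b 3 \<Longrightarrow> f i j k = g i j k"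
  shows "grid_sum b f = grid_sum b g"
  unfolding grid_sum_def by (intro sum.cong refl) (simp add: assms)

lemma grid_sum_add: "grid_sum b (\<lambda>i j k. f i j k + g i j k) = grid_sum b f + grid_sum b g"
  by (simp add: grid_sum_def algebra_simps sum.distrib)

text \<open>The quadrature of \<open>face_term\<close> for an arbitrary integrand, since summation
  by parts concerns two independent grid functions.\<close>

definition plane_sum :: "block \<Rightarrow> 3 \<Rightarrow> nat \<Rightarrow> real grid \<Rightarrow> real" where
  "plane_sum b \<xi> a t =
    (if \<xi> = 1 then \<Sum>j\<le>nn b 2. \<Sum>k\<le>nn b 3. hh b 2 j * hh b 3 k * t a j k
     else if \<xi> = 2 then \<Sum>i\<le>nn b 1. \<Sum>k\<le>nn b 3. hh b 1 i * hh b 3 k * t i a k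
     else \<Sum>i\<le>nn b 1. \<Sum>j\<le>nn b 2. hh b 1 i * hh b 2 j * t i j a)"

lemma face_term_eq:
  "face_term b \<xi> a Q = plane_sum b \<xi> a (\<lambda>i j k. Q i j k \<bullet> flux_F b \<xi> (gpt b i j k) (Q i j k))"
  by (simp add: face_term_def plane_sum_def)

text \<open>\<open>ext_op\<close> acts along single grid lines: the one-dimensional identity holds
  on each of them, and the weights of the other two directions factor out.\<close>

lemma grid_sum_sbp:
  fixes f g :: "'a::euclidean_space grid"
  assumes "dp_sbp (op1 b \<xi>)"
  shows "grid_sum b (\<lambda>i j k. f i j k \<bullet> ext_op b Dminus \<xi> g i j k + ext_op b Dplus \<xi> f i j k \<bullet> g i j k)
    = plane_sum b \<xi> (nn b \<xi>) (\<lambda>i j k. f i j k \<bullet> g i j k)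
      - plane_sum b \<xi> 0 (\<lambda>i j k. f i j k \<bullet> g i j k)"
proof -
  note sbp = dp_sbp_inner[OF assms]
  let ?t = "\<lambda>i j k. f i j k \<bullet> ext_op b Dminus \<xi> g i j k + ext_op b Dplus \<xi> f i j k \<bullet> g i j k"
  consider "\<xi> = 1" | "\<xi> = 2" | "\<xi> = 3" using exhaust_3 by blast
  then show ?thesis
  proof cases
    case 1
    have line: "(\<Sum>i\<le>nn b 1. hh b 1 i * ?t i j k) = f (nn b 1) j k \<bullet> g (nn b 1) j k - f 0 j k \<bullet> g 0 j k" for j k
      using sbp[of "\<lambda>i. f i j k" "\<lambda>i. g i j k"] 1 by (simp add: ext_op_def)
    \<comment> \<open>The sum along the direction of differentiation is moved innermost, to meet
      \<open>line\<close>.\<close>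
    have "grid_sum b ?t = (\<Sum>j\<le>nn b 2. \<Sum>k\<le>nn b 3. \<Sum>i\<le>nn b 1. hh b 1 i * hh b 2 j * hh b 3 k * ?t i j k)"
      unfolding grid_sum_def
      by (subst sum.swap, rule sum.cong[OF refl], rule sum.swap)
    also have "\<dots> = (\<Sum>j\<le>nn b 2. \<Sum>k\<le>nn b 3. hh b 2 j * hh b 3 k * (\<Sum>i\<le>nn b 1. hh b 1 i * ?t i j k))"
      by (simp add: sum_distrib_left mult_ac)
    also have "\<dots> = (\<Sum>j\<le>nn b 2. \<Sum>k\<le>nn b 3. hh b 2 j * hh b 3 k *
        (f (nn b 1) j k \<bullet> g (nn b 1) j k - f 0 j k \<bullet> g 0 j k))"
      by (simp only: line)
    finally show ?thesis
      using 1 by (simp add: plane_sum_def algebra_simps sum_subtractf)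
  next
    case 2
    have line: "(\<Sum>j\<le>nn b 2. hh b 2 j * ?t i j k) = f i (nn b 2) k \<bullet> g i (nn b 2) k - f i 0 k \<bullet> g i 0 k" for i k
      using sbp[of "\<lambda>j. f i j k" "\<lambda>j. g i j k"] 2 by (simp add: ext_op_def)
    have "grid_sum b ?t = (\<Sum>i\<le>nn b 1. \<Sum>k\<le>nn b 3. \<Sum>j\<le>nn b 2. hh b 1 i * hh b 2 j * hh b 3 k * ?t i j k)"
      unfolding grid_sum_def
      by (rule sum.cong[OF refl], rule sum.swap)
    also have "\<dots> = (\<Sum>i\<le>nn b 1. \<Sum>k\<le>nn b 3. hh b 1 i * hh b 3 k * (\<Sum>j\<le>nn b 2. hh b 2 j * ?t i j k))"
      by (simp add: sum_distrib_left mult_ac)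
    also have "\<dots> = (\<Sum>i\<le>nn b 1. \<Sum>k\<le>nn b 3. hh b 1 i * hh b 3 k *
        (f i (nn b 2) k \<bullet> g i (nn b 2) k - f i 0 k \<bullet> g i 0 k))"
      by (simp only: line)
    finally show ?thesis
      using 2 by (simp add: plane_sum_def algebra_simps sum_subtractf)
  next
    case 3
    have line: "(\<Sum>k\<le>nn b 3. hh b 3 k * ?t i j k) = f i j (nn b 3) \<bullet> g i j (nn b 3) - f i j 0 \<bullet> g i j 0" for i j
      using sbp[of "\<lambda>k. f i j k" "\<lambda>k. g i j k"] 3 by (simp add: ext_op_def)
    have "grid_sum b ?t = (\<Sum>i\<le>nn b 1. \<Sum>j\<le>nn b 2. hh b 1 i * hh b 2 j * (\<Sum>k\<le>nn b 3. hh b 3 k * ?t i j k))"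
      by (simp add: grid_sum_def sum_distrib_left mult_ac)
    also have "\<dots> = (\<Sum>i\<le>nn b 1. \<Sum>j\<le>nn b 2. hh b 1 i * hh b 2 j *
        (f i j (nn b 3) \<bullet> g i j (nn b 3) - f i j 0 \<bullet> g i j 0))"
      by (simp only: line)
    finally show ?thesis
      using 3 by (simp add: plane_sum_def algebra_simps sum_subtractf)
  qed
qed

lemma fst_ext_op: "fst (ext_op b D \<xi> f i j k) = ext_op b D \<xi> (\<lambda>i j k. fst (f i j k)) i j k"
  by (simp add: ext_op_def fst_sum)

lemma snd_ext_op: "snd (ext_op b D \<xi> f i j k) = ext_op b D \<xi> (\<lambda>i j k. snd (f i j k)) i j k"
  by (simp add: ext_op_def snd_sum)

text \<open>The volume terms cancel by \<open>inner_ncp_B\<close>: \<open>B\<close> is the pointwise adjoint of \<open>F\<close>.\<close>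

lemma inner_H_spatial_rhs:
  assumes "\<And>\<xi>. dp_sbp (op1 b \<xi>)"
  shows "inner_H b Q (spatial_rhs b Q) = (\<Sum>\<xi>\<in>UNIV. face_term b \<xi> (nn b \<xi>) Q - face_term b \<xi> 0 Q)"
proof -
  let ?F = "\<lambda>\<xi> i j k. fst (flux_F b \<xi> (gpt b i j k) (Q i j k))"
  let ?v = "\<lambda>i j k. fst (Q i j k)"
  have flux: "Q i j k \<bullet> flux_F b \<xi> (gpt b i j k) (Q i j k) = ?v i j k \<bullet> ?F \<xi> i j k" for \<xi> i j k
    by (simp add: flux_F_eq inner_prod_def)
  \<comment> \<open>The stress part of every flux is zero, so only the velocity meets the
    divergence.\<close>
  have div: "Q i j k \<bullet> ext_op b Dminus \<xi> (\<lambda>i j k. flux_F b \<xi> (gpt b i j k) (Q i j k)) i j k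
      = ?v i j k \<bullet> ext_op b Dminus \<xi> (?F \<xi>) i j k" for \<xi> i j k
  proof -
    have "ext_op b Dminus \<xi> (\<lambda>i j k. snd (flux_F b \<xi> (gpt b i j k) (Q i j k))) i j k = 0"
      by (simp add: flux_F_eq ext_op_def)
    then show ?thesis
      by (simp add: inner_prod_def fst_ext_op snd_ext_op)
  qed
  have "Q i j k \<bullet> spatial_rhs b Q i j k = (\<Sum>\<xi>\<in>UNIV. ?v i j k \<bullet> ext_op b Dminus \<xi> (?F \<xi>) i j k
      + ext_op b Dplus \<xi> ?v i j k \<bullet> ?F \<xi> i j k)" for i j k
    by (simp add: spatial_rhs_def inner_add_right inner_sum_right div inner_ncp_B sum.distrib)
  then have "inner_H b Q (spatial_rhs b Q) = (\<Sum>\<xi>\<in>UNIV. grid_sum b (\<lambda>i j k.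
      ?v i j k \<bullet> ext_op b Dminus \<xi> (?F \<xi>) i j k + ext_op b Dplus \<xi> ?v i j k \<bullet> ?F \<xi> i j k))"
    unfolding inner_H_eq sum_3 by (simp add: grid_sum_add)
  also have "\<dots> = (\<Sum>\<xi>\<in>UNIV. face_term b \<xi> (nn b \<xi>) Q - face_term b \<xi> 0 Q)"
    by (intro sum.cong refl) (simp add: grid_sum_sbp[OF assms] face_term_eq flux)
  finally show ?thesis .
qed

subsection \<open>Symmetric positive definite operators\<close>

text \<open>Stated for linear maps instead of matrices, because \<open>P_mat\<close> acts on a
  product type and is inverted by the function inverse \<open>inv\<close>.\<close>

definition spd :: "('a::euclidean_space \<Rightarrow> 'a) \<Rightarrow> bool" where
  "spd A \<longleftrightarrow> linear A \<and> (\<forall>x y. x \<bullet> A y = A x \<bullet> y) \<and> (\<forall>x. x \<noteq> 0 \<longrightarrow> 0 < x \<bullet> A x)"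

lemma spd_nonneg: "spd A \<Longrightarrow> 0 \<le> x \<bullet> A x"
  by (cases "x = 0") (auto simp: spd_def less_imp_le)

text \<open>Positivity makes the kernel trivial, and finite dimension then gives surjectivity. This
  makes \<open>inv A\<close> a two-sided inverse.\<close>

lemma spd_bij:
  assumes "spd A" shows "bij A"
proof -
  have "linear A" using assms by (simp add: spd_def)
  moreover have "inj A"
    using assms by (auto simp: spd_def linear_injective_0)
  ultimately show ?thesis
    by (simp add: bij_def linear_injective_imp_surjective)
qed

lemma spd_inv:
  assumes "spd A" shows "spd (inv A)"
proof -
  have lin: "linear A" and sym: "x \<bullet> A y = A x \<bullet> y" and pos: "x \<noteq> 0 \<Longrightarrow> 0 < x \<bullet> A x" for x y
    using assms by (auto simp: spd_def)
  have inv: "A (inv A x) = x" for x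
    using spd_bij[OF assms] by (simp add: bij_def surj_f_inv_f)
  have "linear (inv A)"
    using spd_bij[OF assms] lin by (metis bij_def inj_linear_imp_inv_linear)
  moreover have "x \<bullet> inv A y = inv A x \<bullet> y" for x y
    using sym[of "inv A x" "inv A y"] by (simp add: inv)
  moreover have "0 < x \<bullet> inv A x" if "x \<noteq> 0" for x
    using pos[of "inv A x"] that inv[of x] linear_0[OF lin]
    by (cases "inv A x = 0") (auto simp: inv inner_commute)
  ultimately show ?thesis by (simp add: spd_def)
qed

lemma spd_scaleR: "spd A \<Longrightarrow> 0 < c \<Longrightarrow> spd (\<lambda>x. c *\<^sub>R A x)"
  by (auto simp: spd_def linear_compose_scale_right)

text \<open>With \<open>u = inv A y\<close> this is the Cauchy-Schwarz inequality of the inner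
  product defined by \<open>A\<close>, for the vectors \<open>x\<close> and
  \<open>u\<close>.\<close>

lemma spd_Cauchy_Schwarz:
  assumes "spd A"
  shows "x \<bullet> y \<le> sqrt (x \<bullet> A x) * sqrt (y \<bullet> inv A y)"
proof (cases "y = 0")
  case False
  have lin: "linear A" and sym: "\<And>x y. x \<bullet> A y = A x \<bullet> y"
    using assms by (auto simp: spd_def)
  define u where "u = inv A y"
  have Au: "A u = y"
    using spd_bij[OF assms] by (simp add: u_def bij_def surj_f_inv_f)
  let ?a = "x \<bullet> A x" and ?b = "x \<bullet> y" and ?c = "y \<bullet> u"
  have c: "0 < ?c"
    using spd_inv[OF assms] False by (auto simp: spd_def u_def)
  \<comment> \<open>This multiple of the \<open>A\<close>-orthogonal projection residual of
    \<open>x\<close> along \<open>u\<close> avoids division; the positive factor \<open>?c\<close>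
    is cancelled afterwards.\<close>
  have "0 \<le> (?c *\<^sub>R x - ?b *\<^sub>R u) \<bullet> A (?c *\<^sub>R x - ?b *\<^sub>R u)"
    by (rule spd_nonneg[OF assms])
  also have "\<dots> = ?c * (?c * ?a - ?b\<^sup>2)"
    using sym[of u x]
    by (simp add: linear_diff[OF lin] linear_scale[OF lin] Au inner_diff_left inner_diff_right
        algebra_simps power2_eq_square inner_commute)
  finally have "?b\<^sup>2 \<le> ?a * ?c"
    using c by (simp add: zero_le_mult_iff mult.commute)
  then show ?thesis
    by (metis u_def real_le_rsqrt real_sqrt_mult)
qed simp

text \<open>After summing the pointwise bounds, Cauchy-Schwarz is applied to the vectors of square
  roots. It serves both the grid sums and the sum over the two blocks.\<close>

lemma sum_le_sqrt_mult_sqrt: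
  fixes x a b :: "'i \<Rightarrow> real"
  assumes "\<And>i. i \<in> A \<Longrightarrow> 0 \<le> a i" "\<And>i. i \<in> A \<Longrightarrow> 0 \<le> b i"
    "\<And>i. i \<in> A \<Longrightarrow> x i \<le> sqrt (a i) * sqrt (b i)"
  shows "(\<Sum>i\<in>A. x i) \<le> sqrt (\<Sum>i\<in>A. a i) * sqrt (\<Sum>i\<in>A. b i)"
proof -
  have "(\<Sum>i\<in>A. x i) \<le> (\<Sum>i\<in>A. \<bar>sqrt (a i)\<bar> * \<bar>sqrt (b i)\<bar>)"
    using assms by (intro sum_mono) auto
  also have "\<dots> \<le> L2_set (\<lambda>i. sqrt (a i)) A * L2_set (\<lambda>i. sqrt (b i)) A"
    by (rule L2_set_mult_ineq)
  also have "\<dots> = sqrt (\<Sum>i\<in>A. a i) * sqrt (\<Sum>i\<in>A. b i)"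
    using assms by (simp add: L2_set_def)
  finally show ?thesis .
qed

section \<open>Positivity and Cauchy-Schwarz for weighted sums over the grid\<close>

lemma grid_sum_nonneg:
  assumes "\<And>\<xi> i. i \<le> nn b \<xi> \<Longrightarrow> 0 < hh b \<xi> i"
    "\<And>i j k. i \<le> nn b 1 \<Longrightarrow> j \<le> nn b 2 \<Longrightarrow> k \<le> nn b 3 \<Longrightarrow> 0 \<le> f i j k"
  shows "0 \<le> grid_sum b f"
  unfolding grid_sum_def
  by (intro sum_nonneg mult_nonneg_nonneg) (auto simp: assms less_imp_le)

text \<open>Each positive weight is split as \<open>sqrt w * sqrt w\<close> between the two factors;
  the unweighted inequality is then used once for each of the three nested sums.\<close>

lemma grid_sum_le_sqrt_mult_sqrt:
  assumes wt: "\<And>\<xi> i. i \<le> nn b \<xi> \<Longrightarrow> 0 < hh b \<xi> i"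
    and f: "\<And>i j k. i \<le> nn b 1 \<Longrightarrow> j \<le> nn b 2 \<Longrightarrow> k \<le> nn b 3 \<Longrightarrow> 0 \<le> f i j k"
    and g: "\<And>i j k. i \<le> nn b 1 \<Longrightarrow> j \<le> nn b 2 \<Longrightarrow> k \<le> nn b 3 \<Longrightarrow> 0 \<le> g i j k"
    and x: "\<And>i j k. i \<le> nn b 1 \<Longrightarrow> j \<le> nn b 2 \<Longrightarrow> k \<le> nn b 3 \<Longrightarrow>
      x i j k \<le> sqrt (f i j k) * sqrt (g i j k)"
  shows "grid_sum b x \<le> sqrt (grid_sum b f) * sqrt (grid_sum b g)"
proof -
  let ?w = "\<lambda>i j k. hh b 1 i * hh b 2 j * hh b 3 k"
  have nonneg: "0 \<le> ?w i j k * f i j k" "0 \<le> ?w i j k * g i j k"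
    and le: "?w i j k * x i j k \<le> sqrt (?w i j k * f i j k) * sqrt (?w i j k * g i j k)"
    if ijk: "i \<in> {..nn b 1}" "j \<in> {..nn b 2}" "k \<in> {..nn b 3}" for i j k
  proof -
    have w: "0 < ?w i j k" using ijk by (simp add: wt)
    show "0 \<le> ?w i j k * f i j k" "0 \<le> ?w i j k * g i j k"
      using w f g ijk by (simp_all add: less_imp_le)
    have "?w i j k * x i j k \<le> (sqrt (?w i j k) * sqrt (?w i j k)) * (sqrt (f i j k) * sqrt (g i j k))"
      using mult_left_mono[OF x[of i j k], of "?w i j k"] w ijk by simp
    also have "\<dots> = sqrt (?w i j k * f i j k) * sqrt (?w i j k * g i j k)"
      by (simp add: real_sqrt_mult mult_ac)
    finally show "?w i j k * x i j k \<le> sqrt (?w i j k * f i j k) * sqrt (?w i j k * g i j k)" .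
  qed
  show ?thesis
    unfolding grid_sum_def by (intro sum_le_sqrt_mult_sqrt sum_nonneg nonneg le)
qed

subsection \<open>Energy norm of a block\<close>

lemma spd_P_mat:
  assumes "0 < rho b (bmap b p)" "transpose (stiff b (bmap b p)) = stiff b (bmap b p)"
    "\<And>w. w \<noteq> 0 \<Longrightarrow> 0 < w \<bullet> (stiff b (bmap b p) *v w)"
  shows "spd (P_mat b p)"
proof -
  let ?C = "stiff b (bmap b p)" and ?r = "1 / rho b (bmap b p)"
  have sym: "x \<bullet> (?C *v y) = (?C *v x) \<bullet> y" for x y
    by (metis assms(2) dot_lmul_matrix transpose_matrix_vector)
  have "linear (P_mat b p)"
    by (intro linearI)
       (auto simp: P_mat_def matrix_vector_right_distrib matrix_vector_mult_scaleR algebra_simps)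
  moreover have "x \<bullet> P_mat b p y = P_mat b p x \<bullet> y" for x y
    by (simp add: P_mat_def inner_prod_def sym)
  \<comment> \<open>If the stress part vanishes, the velocity part is nonzero and the density gives
    positivity; otherwise the stiffness does.\<close>
  moreover have "0 < x \<bullet> P_mat b p x" if "x \<noteq> 0" for x
  proof (cases "snd x = 0")
    case True
    then show ?thesis
      using that assms(1) by (auto simp: P_mat_def inner_prod_def prod_eq_iff)
  next
    case False
    have "0 \<le> fst x \<bullet> (?r *\<^sub>R fst x)"
      using assms(1) by simp
    then show ?thesis
      using assms(3)[OF False] by (simp add: P_mat_def inner_prod_def)
  qed
  ultimately show ?thesis by (simp add: spd_def)
qed

lemma gpt_in_unit_cube:
  assumes "i \<le> nn b 1" "j \<le> nn b 2" "k \<le> nn b 3"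
  shows "gpt b i j k \<in> unit_cube"
  using assms by (auto simp: gpt_def unit_cube_def forall_3 divide_le_eq_1)

context
  fixes b :: block
  assumes valid: "valid_block b"
begin

lemma dp_sbp_block: "dp_sbp (op1 b \<xi>)"
  using valid by (simp add: valid_block_def)

lemma npts_pos: "0 < nn b \<xi>"
  using dp_sbp_block[of \<xi>] by (simp add: dp_sbp_def)

lemma wt_pos: "i \<le> nn b \<xi> \<Longrightarrow> 0 < hh b \<xi> i"
  using dp_sbp_block[of \<xi>] by (simp add: dp_sbp_def)

lemma jac_pos: "p \<in> unit_cube \<Longrightarrow> 0 < jac b p"
  using valid by (simp add: valid_block_def)

lemma spd_half_Ptilde_inv:
  assumes "p \<in> unit_cube"
  shows "spd (half_Ptilde_inv b p)"
proof -
  have "spd (P_mat b p)"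
    using valid assms by (intro spd_P_mat) (auto simp: valid_block_def)
  then have "spd (\<lambda>Q. (jac b p / 2) *\<^sub>R inv (P_mat b p) Q)"
    using jac_pos[OF assms] by (intro spd_scaleR spd_inv) auto
  moreover have "half_Ptilde_inv b p = (\<lambda>Q. (jac b p / 2) *\<^sub>R inv (P_mat b p) Q)"
    by (simp add: half_Ptilde_inv_def Ptilde_inv_def fun_eq_iff)
  ultimately show ?thesis by simp
qed

lemma spd_at_grid:
  assumes "i \<le> nn b 1" "j \<le> nn b 2" "k \<le> nn b 3"
  shows "spd (half_Ptilde_inv b (gpt b i j k))"
  by (rule spd_half_Ptilde_inv[OF gpt_in_unit_cube[OF assms]])

lemma hp_sq_nonneg: "0 \<le> hp_sq b Q"
  unfolding hp_sq_def inner_H_eq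
  by (rule grid_sum_nonneg[OF wt_pos spd_nonneg[OF spd_at_grid]])

lemma hpinv_sq_nonneg: "0 \<le> hpinv_sq b Q"
  unfolding hpinv_sq_def inner_H_eq
  by (rule grid_sum_nonneg[OF wt_pos spd_nonneg[OF spd_inv[OF spd_at_grid]]])

lemma inner_H_le: "inner_H b Q T \<le> sqrt (hp_sq b Q) * sqrt (hpinv_sq b T)"
  unfolding hp_sq_def hpinv_sq_def inner_H_eq
  by (rule grid_sum_le_sqrt_mult_sqrt[OF wt_pos spd_nonneg[OF spd_at_grid]
        spd_nonneg[OF spd_inv[OF spd_at_grid]] spd_Cauchy_Schwarz[OF spd_at_grid]])

text \<open>Symmetry makes the two terms of the product rule equal, which absorbs the factor 1/2 and
  leaves the left side of the error equation.\<close>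

lemma hp_sq_has_derivative:
  assumes "\<And>i j k. i \<le> nn b 1 \<Longrightarrow> j \<le> nn b 2 \<Longrightarrow> k \<le> nn b 3 \<Longrightarrow>
    ((\<lambda>\<tau>. E \<tau> i j k) has_vector_derivative E' i j k) (at t within I)"
  shows "((\<lambda>\<tau>. hp_sq b (E \<tau>)) has_real_derivative
    inner_H b (E t) (\<lambda>i j k. Ptilde_inv b (gpt b i j k) (E' i j k))) (at t within I)"
  unfolding hp_sq_def inner_H_def
proof (intro DERIV_sum DERIV_cmult)
  fix i j k assume ijk: "i \<in> {..nn b 1}" "j \<in> {..nn b 2}" "k \<in> {..nn b 3}"
  let ?A = "half_Ptilde_inv b (gpt b i j k)"
  have spd: "spd ?A" using ijk by (simp add: spd_at_grid)
  then have "bounded_linear ?A" by (simp add: spd_def linear_conv_bounded_linear)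
  moreover have E: "((\<lambda>\<tau>. E \<tau> i j k) has_vector_derivative E' i j k) (at t within I)"
    using assms ijk by simp
  ultimately have "((\<lambda>\<tau>. ?A (E \<tau> i j k)) has_vector_derivative ?A (E' i j k)) (at t within I)"
    by (rule bounded_linear.has_vector_derivative)
  from bounded_bilinear.has_vector_derivative[OF bounded_bilinear_inner E this]
  have "((\<lambda>\<tau>. E \<tau> i j k \<bullet> ?A (E \<tau> i j k)) has_real_derivative
      E t i j k \<bullet> ?A (E' i j k) + E' i j k \<bullet> ?A (E t i j k)) (at t within I)"
    by (simp add: has_real_derivative_iff_has_vector_derivative)
  moreover have "E' i j k \<bullet> ?A (E t i j k) = E t i j k \<bullet> ?A (E' i j k)"
    using spd unfolding spd_def by (metis inner_commute)
  ultimately show "((\<lambda>\<tau>. E \<tau> i j k \<bullet> ?A (E \<tau> i j k)) has_real_derivative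
      E t i j k \<bullet> Ptilde_inv b (gpt b i j k) (E' i j k)) (at t within I)"
    by (simp add: half_Ptilde_inv_def)
qed

subsection \<open>Geometry of the fault\<close>

lemma
  assumes "p \<in> unit_cube"
  shows bmap_has_derivative: "(bmap b has_derivative frechet_derivative (bmap b) (at p)) (at p)"
    and linear_bcoord_derivative: "linear (frechet_derivative (bcoord b) (at (bmap b p)))"
    and bcoord_derivative_bmap_derivative:
      "frechet_derivative (bcoord b) (at (bmap b p)) (frechet_derivative (bmap b) (at p) v) = v"
proof -
  let ?X = "frechet_derivative (bmap b) (at p)"
  let ?Y = "frechet_derivative (bcoord b) (at (bmap b p))"
  obtain U V where U: "open U" "unit_cube \<subseteq> U" "bmap b ` U = V" and inv: "\<forall>q\<in>U. bcoord b (bmap b q) = q"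
    and smooth: "smooth_on U (bmap b)" "smooth_on V (bcoord b)"
    using valid by (auto simp: valid_block_def)
  have p: "p \<in> U" using U assms by auto
  have diff: "f differentiable (at x)" if "smooth_on W f" "x \<in> W" for f x W
    using that(2) that(1)[unfolded smooth_on_def, THEN spec, of "Suc 0"] by simp
  have "bmap b differentiable (at p)" "bcoord b differentiable (at (bmap b p))"
    using diff smooth p U(3) by auto
  then have X: "(bmap b has_derivative ?X) (at p)" and Y: "(bcoord b has_derivative ?Y) (at (bmap b p))"
    using frechet_derivative_works by blast+
  \<comment> \<open>The composite is the identity on the open set \<open>U\<close>, also around
    boundary points of the cube; uniqueness compares its derivative with the chain rule.\<close>
  have "((\<lambda>q. bcoord b (bmap b q)) has_derivative (\<lambda>v. v)) (at p)"
    by (rule has_derivative_transform_within_open[OF has_derivative_ident U(1) p]) (simp add: inv)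
  from has_derivative_unique[OF has_derivative_compose[OF X Y] this]
  show "?Y (?X v) = v" by (rule fun_cong)
  show "(bmap b has_derivative ?X) (at p)" "linear ?Y"
    using X Y by (auto simp: has_derivative_linear)
qed

text \<open>\<open>J\<close> times the gradient of \<open>q\<close> is a vector of cofactors, hence only involves tangential
  derivatives of the parametrization.\<close>

lemma jac_grad_coord_1:
  assumes p: "p \<in> unit_cube"
  defines "X \<equiv> \<lambda>c. frechet_derivative (bmap b) (at p) (axis c 1)"
  shows "jac b p *\<^sub>R grad_coord b 1 p = cross3 (X 2) (X 3)"
proof -
  let ?Y = "frechet_derivative (bcoord b) (at (bmap b p))"
  define M where "M = matrix (frechet_derivative (bmap b) (at p))"
  have col: "column c M = X c" for c
    by (simp add: M_def X_def column_def matrix_def vec_eq_iff)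
  have grad: "grad_coord b 1 p \<bullet> v = ?Y v $ 1" for v
  proof -
    have "?Y v = ?Y (\<Sum>a\<in>UNIV. v $ a *\<^sub>R axis a 1)"
      by (simp add: basis_expansion flip: scalar_mult_eq_scaleR)
    also have "\<dots> = (\<Sum>a\<in>UNIV. v $ a *\<^sub>R ?Y (axis a 1))"
      by (simp add: linear_sum[OF linear_bcoord_derivative[OF p]]
          linear_scale[OF linear_bcoord_derivative[OF p]])
    finally show ?thesis
      by (simp add: grad_coord_def inner_vec_def mult.commute)
  qed
  \<comment> \<open>The gradient of \<open>q\<close> is the first vector of the basis dual to the
    columns of the Jacobian matrix.\<close>
  have dual: "grad_coord b 1 p \<bullet> X c = (if c = 1 then 1 else 0)" for c
    by (simp add: grad X_def bcoord_derivative_bmap_derivative[OF p] axis_def)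
  have jac: "jac b p = X 1 \<bullet> cross3 (X 2) (X 3)"
    by (simp add: jac_def flip: M_def col) (simp add: cross3_simps column_def)
  \<comment> \<open>\<open>w\<close> is orthogonal to all columns of \<open>M\<close>, which span
    the space because the Jacobian determinant is positive.\<close>
  define w where "w = jac b p *\<^sub>R grad_coord b 1 p - cross3 (X 2) (X 3)"
  have "X c \<bullet> w = 0" for c
    using exhaust_3[of c] dual[of c] jac
    by (auto simp: w_def inner_diff_right inner_commute[of "X c" "grad_coord b 1 p"] dot_cross_self)
  then have "transpose M *v w = 0"
    by (simp add: vec_eq_iff matrix_vector_mult_def transpose_def inner_vec_def column_def flip: col)
  moreover have "invertible (transpose M)"
    using jac_pos[OF p] by (simp add: invertible_det_nz det_transpose jac_def M_def)
  ultimately have "w = 0"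
    by (metis invertible_left_inverse matrix_left_invertible_ker)
  then show ?thesis by (simp add: w_def)
qed

end

section \<open>Equality of the fault geometry computed in the two blocks\<close>

lemma has_vector_derivative_along_line:
  assumes "(f has_derivative f') (at p)"
  shows "((\<lambda>t. f (p + (t - r) *\<^sub>R e)) has_vector_derivative f' e) (at r within T)"
proof -
  have "((\<lambda>t. p + (t - r) *\<^sub>R e) has_derivative (\<lambda>h. h *\<^sub>R e)) (at r within T)"
    by (auto intro!: derivative_eq_intros)
  from has_derivative_compose[OF this, of f f'] show ?thesis
    using assms by (simp add: has_vector_derivative_def linear_scale[OF has_derivative_linear[OF assms]])
qed

text \<open>The maps agree only on a segment, and \<open>r\<close> may be an end point of it;
  derivatives within a nondegenerate closed interval are still unique.\<close>

lemma frechet_derivative_eq_along_segment: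
  fixes f g :: "'a::real_normed_vector \<Rightarrow> 'b::real_normed_vector"
  assumes f: "(f has_derivative f') (at p)" and g: "(g has_derivative g') (at q)"
    and r: "r \<in> {0..1}"
    and eq: "\<And>t. t \<in> {0..1} \<Longrightarrow> f (p + (t - r) *\<^sub>R e) = g (q + (t - r) *\<^sub>R e)"
  shows "f' e = g' e"
proof (rule vector_derivative_unique_within_closed_interval[of 0 1 r])
  show "((\<lambda>t. f (p + (t - r) *\<^sub>R e)) has_vector_derivative f' e) (at r within cbox 0 1)"
    by (rule has_vector_derivative_along_line[OF f])
  show "((\<lambda>t. f (p + (t - r) *\<^sub>R e)) has_vector_derivative g' e) (at r within cbox 0 1)"
    by (rule has_vector_derivative_transform[OF _ _ has_vector_derivative_along_line[OF g]])
       (use r eq in \<open>auto simp: box_real\<close>)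
qed (use r in auto)

text \<open>By \<open>jac_grad_coord_1\<close> both cofactor vectors are cross products of the
  tangents in \<open>r\<close> and \<open>s\<close>, which agree since the parametrizations agree on
  the whole face.\<close>

lemma shared_fault_cofactors:
  assumes valid: "valid_block bm" "valid_block bp" and fault: "shared_fault bm bp"
    and jk: "j \<le> nn bm 2" "k \<le> nn bm 3"
  shows "jac bp (gpt bp 0 j k) *\<^sub>R grad_coord bp 1 (gpt bp 0 j k)
    = fault_fac bm j k *\<^sub>R fault_normal bm j k"
proof -
  let ?p = "gpt bm (nn bm 1) j k" and ?q = "gpt bp 0 j k"
  define r s where "r = real j / real (nn bm 2)" and "s = real k / real (nn bm 3)"
  have nn: "nn bp 2 = nn bm 2" "nn bp 3 = nn bm 3"
    using fault by (auto simp: shared_fault_def)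
  have p: "?p = vector [1, r, s]" and q: "?q = vector [0, r, s]"
    using npts_pos[OF valid(1), of 1] by (simp_all add: gpt_def r_def s_def nn)
  have rs: "r \<in> {0..1}" "s \<in> {0..1}"
    using jk npts_pos[OF valid(1)] by (simp_all add: r_def s_def divide_le_eq_1)
  have pc: "?p \<in> unit_cube" "?q \<in> unit_cube"
    using jk nn by (auto intro!: gpt_in_unit_cube)
  have eq: "bmap bm (vector [1, r, s]) = bmap bp (vector [0, r, s])"
    if "r \<in> {0..1}" "s \<in> {0..1}" for r s
    using fault that by (simp add: shared_fault_def)
  have ax: "vector [x, y, z] + (t - y) *\<^sub>R axis 2 1 = (vector [x, t, z] :: real^3)"
    "vector [x, y, z] + (t - z) *\<^sub>R axis 3 1 = (vector [x, y, t] :: real^3)" for x y z t :: real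
    by (simp_all add: vec_eq_iff forall_3 axis_def)
  note d = bmap_has_derivative[OF valid(1) pc(1)] bmap_has_derivative[OF valid(2) pc(2)]
  have "frechet_derivative (bmap bm) (at ?p) (axis 2 1) = frechet_derivative (bmap bp) (at ?q) (axis 2 1)"
    by (rule frechet_derivative_eq_along_segment[OF d rs(1)])
       (simp add: p q ax eq rs del: atLeastAtMost_iff)
  moreover have "frechet_derivative (bmap bm) (at ?p) (axis 3 1) = frechet_derivative (bmap bp) (at ?q) (axis 3 1)"
    by (rule frechet_derivative_eq_along_segment[OF d rs(2)])
       (simp add: p q ax eq rs del: atLeastAtMost_iff)
  ultimately have "jac bp ?q *\<^sub>R grad_coord bp 1 ?q = jac bm ?p *\<^sub>R grad_coord bm 1 ?p"
    using jac_grad_coord_1[OF valid(1) pc(1)] jac_grad_coord_1[OF valid(2) pc(2)] by simp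
  then show ?thesis
    by (simp add: fault_fac_def fault_normal_def fault_grad_def)
qed

subsection \<open>Power of the interface terms\<close>

lemma fault_int_nonneg:
  assumes "valid_block bm" "\<And>j k. j \<le> nn bm 2 \<Longrightarrow> k \<le> nn bm 3 \<Longrightarrow> 0 \<le> g j k"
  shows "0 \<le> fault_int bm g"
  unfolding fault_int_def fault_fac_def
  by (intro sum_nonneg mult_nonneg_nonneg)
     (auto simp: assms(2) less_imp_le[OF jac_pos[OF assms(1) gpt_in_unit_cube]]
        less_imp_le[OF wt_pos[OF assms(1)]])

lemma fault_int_cong:
  assumes "\<And>j k. j \<le> nn bm 2 \<Longrightarrow> k \<le> nn bm 3 \<Longrightarrow> f j k = g j k"
  shows "fault_int bm f = fault_int bm g"
  unfolding fault_int_def by (intro sum.cong refl) (simp add: assms)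

lemma fault_int_add: "fault_int bm (\<lambda>j k. f j k + g j k) = fault_int bm f + fault_int bm g"
  by (simp add: fault_int_def algebra_simps sum.distrib)

lemma fault_int_diff: "fault_int bm (\<lambda>j k. f j k - g j k) = fault_int bm f - fault_int bm g"
  by (simp add: fault_int_def algebra_simps sum_subtractf)

lemma fault_int_minus: "fault_int bm (\<lambda>j k. - f j k) = - fault_int bm f"
  by (simp add: fault_int_def sum_negf)

lemma F_luc_nonpos:
  assumes "valid_block bm" "\<And>j k c. j \<le> nn bm 2 \<Longrightarrow> k \<le> nn bm 3 \<Longrightarrow> 0 < Z j k $ c"
  shows "F_luc bm G Z \<le> 0"
  unfolding F_luc_def neg_le_0_iff_le
  by (intro fault_int_nonneg[OF assms(1)] sum_nonneg) (simp add: less_imp_le[OF assms(2)])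

lemma IT_s_nonpos:
  assumes "valid_block bm" "0 \<le> \<alpha>"
  shows "IT_s bm \<alpha> wm wp \<le> 0"
  unfolding IT_s_def neg_le_0_iff_le
  by (intro fault_int_nonneg[OF assms(1)]) (simp add: assms(2))

text \<open>The factor \<open>1 / hh\<close> of the penalty cancels the weight of the face in
  direction \<open>q\<close>, turning the volume sum into a fault integral.\<close>

lemma inner_H_sat_minus:
  assumes "valid_block bm"
  shows "inner_H bm Q (sat_minus bm S) = - fault_int bm (\<lambda>j k. Q (nn bm 1) j k \<bullet> S j k)"
proof -
  let ?N = "nn bm 1"
  have h: "hh bm 1 ?N \<noteq> 0" using wt_pos[OF assms order_refl, of 1] by simp
  have "inner_H bm Q (sat_minus bm S) = (\<Sum>i\<le>?N. if i = ?N then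
      - fault_int bm (\<lambda>j k. Q ?N j k \<bullet> S j k) else 0)"
    unfolding inner_H_def
  proof (rule sum.cong[OF refl])
    fix i
    show "(\<Sum>j\<le>nn bm 2. \<Sum>k\<le>nn bm 3. hh bm 1 i * hh bm 2 j * hh bm 3 k * (Q i j k \<bullet> sat_minus bm S i j k))
        = (if i = ?N then - fault_int bm (\<lambda>j k. Q ?N j k \<bullet> S j k) else 0)"
      using h by (simp add: sat_minus_def fault_int_def sum_negf mult_ac)
  qed
  then show ?thesis by simp
qed

text \<open>The weight in direction \<open>q\<close> belongs to the plus block and cancels; the
  tangential weights are shared, so the integral can be taken in the minus block.\<close>

lemma inner_H_sat_plus:
  assumes "valid_block bp" "shared_fault bm bp"
  shows "inner_H bp Q (sat_plus bm bp S) = - fault_int bm (\<lambda>j k. Q 0 j k \<bullet> S j k)"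
proof -
  have h: "hh bp 1 0 \<noteq> 0" using wt_pos[OF assms(1), of 0 1] by simp
  have nn: "nn bp 2 = nn bm 2" "nn bp 3 = nn bm 3"
    and hh: "\<And>j. j \<le> nn bm 2 \<Longrightarrow> hh bp 2 j = hh bm 2 j" "\<And>k. k \<le> nn bm 3 \<Longrightarrow> hh bp 3 k = hh bm 3 k"
    using assms(2) by (auto simp: shared_fault_def)
  have "inner_H bp Q (sat_plus bm bp S) = (\<Sum>i\<le>nn bp 1. if i = 0 then
      - fault_int bm (\<lambda>j k. Q 0 j k \<bullet> S j k) else 0)"
    unfolding inner_H_def
  proof (rule sum.cong[OF refl])
    fix i
    show "(\<Sum>j\<le>nn bp 2. \<Sum>k\<le>nn bp 3. hh bp 1 i * hh bp 2 j * hh bp 3 k * (Q i j k \<bullet> sat_plus bm bp S i j k))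
        = (if i = 0 then - fault_int bm (\<lambda>j k. Q 0 j k \<bullet> S j k) else 0)"
      using h by (simp add: sat_plus_def fault_int_def sum_negf nn hh mult_ac)
  qed
  then show ?thesis by simp
qed

section \<open>Penalty and face terms in local fault components\<close>

lemma orthonormal3_rot_inner:
  assumes "orthonormal3 n m l"
  shows "(rot n m l *v x) \<bullet> (rot n m l *v y) = x \<bullet> y"
proof -
  let ?R = "rot n m l"
  have "?R ** transpose ?R = mat 1"
    using assms
    by (simp add: vec_eq_iff forall_3 matrix_matrix_mult_def transpose_def rot_def mat_def
        orthonormal3_def norm_eq_1 inner_vec_def mult.commute)
  \<comment> \<open>A right inverse of a square matrix is also a left inverse.\<close>
  then have "orthogonal_matrix ?R"
    by (simp add: orthogonal_matrix_def matrix_left_right_inverse)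
  then show ?thesis
    by (metis orthogonal_transformation_matrix matrix_of_matrix_vector_mul
        matrix_vector_mul_linear orthogonal_transformation_def)
qed

lemma inner_vector_matrix_mult: "x \<bullet> (y v* A) = (A *v x) \<bullet> y" for A :: "real^'n^'m"
  by (metis dot_lmul_matrix inner_commute)

text \<open>\<open>inner_voigt\<close> turns the stress penalty into a pairing with the traction,
  and moving \<open>transpose R\<close> across the inner product produces local components.\<close>

lemma inner_sat_val:
  "Q \<bullet> sat_val \<epsilon> R n Z G = local_v R Q \<bullet> G - \<epsilon> * (local_T R n Q \<bullet> (\<chi> c. G $ c / Z $ c))"
  by (simp add: sat_val_def local_v_def local_T_def inner_prod_def inner_voigt
      inner_vector_matrix_mult)

lemma inner_flux_F:
  "Q \<bullet> flux_F b \<xi> p Q = fst Q \<bullet> (stress_mat (snd Q) *v (jac b p *\<^sub>R grad_coord b \<xi> p))"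
  by (simp add: flux_F_eq inner_prod_def matrix_vector_mult_scaleR)

lemma face_term_minus:
  assumes frame: "\<And>j k. j \<le> nn bm 2 \<Longrightarrow> k \<le> nn bm 3 \<Longrightarrow>
      orthonormal3 (fault_normal bm j k) (m j k) (l j k)"
    and R: "\<And>j k. R j k = rot (fault_normal bm j k) (m j k) (l j k)"
  shows "face_term bm 1 (nn bm 1) Q = fault_int bm (\<lambda>j k.
    local_v (R j k) (Q (nn bm 1) j k) \<bullet> local_T (R j k) (fault_normal bm j k) (Q (nn bm 1) j k))"
proof -
  \<comment> \<open>A zero gradient would be harmless here, as both sides are then zero.\<close>
  have "jac bm (gpt bm (nn bm 1) j k) *\<^sub>R grad_coord bm 1 (gpt bm (nn bm 1) j k)
      = fault_fac bm j k *\<^sub>R fault_normal bm j k" for j k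
    by (simp add: fault_fac_def fault_normal_def fault_grad_def)
  then show ?thesis
    unfolding face_term_eq plane_sum_def fault_int_def local_v_def local_T_def R inner_flux_F
    by (simp add: orthonormal3_rot_inner[OF frame] matrix_vector_mult_scaleR mult_ac)
qed

text \<open>The normal is the one of the minus block, so the formula has the same sign as there; the
  minus sign of the end \<open>q = 0\<close> comes from summation by parts.\<close>

lemma face_term_plus:
  assumes valid: "valid_block bm" "valid_block bp" "shared_fault bm bp"
    and frame: "\<And>j k. j \<le> nn bm 2 \<Longrightarrow> k \<le> nn bm 3 \<Longrightarrow>
      orthonormal3 (fault_normal bm j k) (m j k) (l j k)"
    and R: "\<And>j k. R j k = rot (fault_normal bm j k) (m j k) (l j k)"
  shows "face_term bp 1 0 Q = fault_int bm (\<lambda>j k.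
    local_v (R j k) (Q 0 j k) \<bullet> local_T (R j k) (fault_normal bm j k) (Q 0 j k))"
proof -
  have nn: "nn bp 2 = nn bm 2" "nn bp 3 = nn bm 3"
    and hh: "\<And>j. j \<le> nn bm 2 \<Longrightarrow> hh bp 2 j = hh bm 2 j" "\<And>k. k \<le> nn bm 3 \<Longrightarrow> hh bp 3 k = hh bm 3 k"
    using valid(3) by (auto simp: shared_fault_def)
  show ?thesis
    unfolding face_term_eq plane_sum_def fault_int_def local_v_def local_T_def R inner_flux_F
    by (simp add: orthonormal3_rot_inner[OF frame] matrix_vector_mult_scaleR mult_ac nn hh
        shared_fault_cofactors[OF valid])
qed

text \<open>Since \<open>T - G = S\<close> and \<open>v = w + G / Z\<close>, the left side is
  \<open>v * S - T * G / Z = w * S - (T - S) * G / Z\<close>.\<close>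

lemma penalty_minus_power:
  fixes v w T S G Z :: real
  assumes "0 < Z" "Z * w - S = Z * v - T" "G = 1/2 * Z * (v - w) + 1/2 * (T - S)"
  shows "v * T - (v * G + T * (G / Z)) = w * S - G\<^sup>2 / Z"
proof -
  have G: "G = T - S" and v: "v = w + (T - S) / Z"
    using assms by (simp_all add: field_simps)
  show ?thesis using assms(1) unfolding G v by (simp add: field_simps power2_eq_square)
qed

text \<open>Here \<open>T + G = S\<close> and again \<open>v = w + G / Z\<close>, so the left side
  is \<open>- v * S + T * G / Z = - w * S - (S - T) * G / Z\<close>.\<close>

lemma penalty_plus_power:
  fixes v w T S G Z :: real
  assumes "0 < Z" "Z * w + S = Z * v + T" "G = 1/2 * Z * (v - w) - 1/2 * (T - S)"
  shows "- (v * T) - (v * G - T * (G / Z)) = - (w * S) - G\<^sup>2 / Z"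
proof -
  have G: "G = S - T" and v: "v = w + (S - T) / Z"
    using assms by (simp_all add: field_simps)
  show ?thesis using assms(1) unfolding G v by (simp add: field_simps power2_eq_square)
qed

lemma interface_power:
  assumes "hat_conditions \<alpha> Zm Zp vm Tm vp Tp wm wp S"
    and pos: "\<And>c. 0 < Zm $ c \<and> 0 < Zp $ c"
    and Gm: "Gm = penalty_G (-1) Zm vm wm Tm S" and Gp: "Gp = penalty_G 1 Zp vp wp Tp S"
  shows "vm \<bullet> Tm - (vm \<bullet> Gm + Tm \<bullet> (\<chi> c. Gm $ c / Zm $ c))
      + (- (vp \<bullet> Tp) - (vp \<bullet> Gp - Tp \<bullet> (\<chi> c. Gp $ c / Zp $ c)))
    = - (\<Sum>c\<in>UNIV. 1 / Zm $ c * \<bar>Gm $ c\<bar>\<^sup>2) - (\<Sum>c\<in>UNIV. 1 / Zp $ c * \<bar>Gp $ c\<bar>\<^sup>2)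
      - \<alpha> * ((wp $ 3 - wm $ 3)\<^sup>2 + (wp $ 2 - wm $ 2)\<^sup>2)"
proof -
  have hat: "\<And>c. Zp $ c * wp $ c + S $ c = Zp $ c * vp $ c + Tp $ c"
      "\<And>c. Zm $ c * wm $ c - S $ c = Zm $ c * vm $ c - Tm $ c"
    and jump: "wp $ 1 = wm $ 1" "S $ 2 = \<alpha> * (wp $ 2 - wm $ 2)" "S $ 3 = \<alpha> * (wp $ 3 - wm $ 3)"
    using assms(1) by (auto simp: hat_conditions_def)
  have m: "vm $ c * Tm $ c - (vm $ c * Gm $ c + Tm $ c * (Gm $ c / Zm $ c))
      = wm $ c * S $ c - (Gm $ c)\<^sup>2 / Zm $ c" for c
    by (rule penalty_minus_power[OF _ hat(2)]) (simp_all add: pos Gm penalty_G_def diff_divide_distrib)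
  have p: "- (vp $ c * Tp $ c) - (vp $ c * Gp $ c - Tp $ c * (Gp $ c / Zp $ c))
      = - (wp $ c * S $ c) - (Gp $ c)\<^sup>2 / Zp $ c" for c
    by (rule penalty_plus_power[OF _ hat(1)]) (simp_all add: pos Gp penalty_G_def)
  have "vm \<bullet> Tm - (vm \<bullet> Gm + Tm \<bullet> (\<chi> c. Gm $ c / Zm $ c))
      = (\<Sum>c\<in>UNIV. wm $ c * S $ c) - (\<Sum>c\<in>UNIV. (Gm $ c)\<^sup>2 / Zm $ c)"
    by (simp add: inner_vec_def sum.distrib[symmetric] sum_subtractf[symmetric] m[unfolded times_divide_eq_right])
  moreover have "- (vp \<bullet> Tp) - (vp \<bullet> Gp - Tp \<bullet> (\<chi> c. Gp $ c / Zp $ c))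
      = - (\<Sum>c\<in>UNIV. wp $ c * S $ c) - (\<Sum>c\<in>UNIV. (Gp $ c)\<^sup>2 / Zp $ c)"
    by (simp add: inner_vec_def sum_negf[symmetric] sum_subtractf[symmetric] p[unfolded times_divide_eq_right])
  \<comment> \<open>The normal component drops out by continuity of the normal velocity; friction
    replaces \<open>S\<close> in the tangential components 2 and 3.\<close>
  moreover have "(\<Sum>c\<in>UNIV. wm $ c * S $ c) - (\<Sum>c\<in>UNIV. wp $ c * S $ c)
      = - \<alpha> * ((wp $ 3 - wm $ 3)\<^sup>2 + (wp $ 2 - wm $ 2)\<^sup>2)"
    by (simp add: sum_3 jump power2_eq_square algebra_simps)
  ultimately show ?thesis by (simp add: algebra_simps)
qed

text \<open>Since \<open>I\<close> is a nondegenerate interval, the derivative within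
  \<open>I\<close> is unique, and one-sided at an end point; the quantified \<open>D\<close> is
  therefore the rate of the energy.\<close>

theorem theorem7:
  fixes bm bp :: block
    and \<alpha> :: real
    and I :: "real set"
    and Em Ep Em' Ep' Tm Tp :: "real \<Rightarrow> field9 grid"
    and mv lv :: "nat \<Rightarrow> nat \<Rightarrow> real^3"
    and R :: "nat \<Rightarrow> nat \<Rightarrow> real^3^3"
    and Zm Zp :: "nat \<Rightarrow> nat \<Rightarrow> real^3"
    and evm evp eTm eTp wm wp S Gm Gp :: "real \<Rightarrow> nat \<Rightarrow> nat \<Rightarrow> real^3"
  assumes blocks: "valid_block bm" "valid_block bp" "shared_fault bm bp"
    and alpha: "\<alpha> \<ge> 0"
    and interval: "is_interval I" "\<exists>a\<in>I. \<exists>b\<in>I. a < b"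
    and frame: "\<And>j k. j \<le> nn bm 2 \<Longrightarrow> k \<le> nn bm 3 \<Longrightarrow>
        orthonormal3 (fault_normal bm j k) (mv j k) (lv j k)"
    and rotation: "\<And>j k. R j k = rot (fault_normal bm j k) (mv j k) (lv j k)"
    and impedance: "\<And>j k c. j \<le> nn bm 2 \<Longrightarrow> k \<le> nn bm 3 \<Longrightarrow> 0 < Zm j k $ c \<and> 0 < Zp j k $ c"
    and evm: "\<And>t j k. evm t j k = local_v (R j k) (Em t (nn bm 1) j k)"
    and evp: "\<And>t j k. evp t j k = local_v (R j k) (Ep t 0 j k)"
    and eTm: "\<And>t j k. eTm t j k = local_T (R j k) (fault_normal bm j k) (Em t (nn bm 1) j k)"
    and eTp: "\<And>t j k. eTp t j k = local_T (R j k) (fault_normal bm j k) (Ep t 0 j k)"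
    and hats: "\<And>t j k. t \<in> I \<Longrightarrow> j \<le> nn bm 2 \<Longrightarrow> k \<le> nn bm 3 \<Longrightarrow>
        hat_conditions \<alpha> (Zm j k) (Zp j k) (evm t j k) (eTm t j k) (evp t j k) (eTp t j k)
          (wm t j k) (wp t j k) (S t j k)"
    and Gm: "\<And>t j k. Gm t j k =
        penalty_G (-1) (Zm j k) (evm t j k) (wm t j k) (eTm t j k) (S t j k)"
    and Gp: "\<And>t j k. Gp t j k =
        penalty_G 1 (Zp j k) (evp t j k) (wp t j k) (eTp t j k) (S t j k)"
    and diff_m: "\<And>t i j k. t \<in> I \<Longrightarrow> i \<le> nn bm 1 \<Longrightarrow> j \<le> nn bm 2 \<Longrightarrow> k \<le> nn bm 3 \<Longrightarrow>
        ((\<lambda>\<tau>. Em \<tau> i j k) has_vector_derivative Em' t i j k) (at t within I)"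
    and diff_p: "\<And>t i j k. t \<in> I \<Longrightarrow> i \<le> nn bp 1 \<Longrightarrow> j \<le> nn bp 2 \<Longrightarrow> k \<le> nn bp 3 \<Longrightarrow>
        ((\<lambda>\<tau>. Ep \<tau> i j k) has_vector_derivative Ep' t i j k) (at t within I)"
    and error_m: "\<And>t i j k. t \<in> I \<Longrightarrow> i \<le> nn bm 1 \<Longrightarrow> j \<le> nn bm 2 \<Longrightarrow> k \<le> nn bm 3 \<Longrightarrow>
        Ptilde_inv bm (gpt bm i j k) (Em' t i j k) =
          spatial_rhs bm (Em t) i j k
          + sat_minus bm (\<lambda>j k. sat_val (-1) (R j k) (fault_normal bm j k) (Zm j k) (Gm t j k)) i j k
          + Tm t i j k"
    and error_p: "\<And>t i j k. t \<in> I \<Longrightarrow> i \<le> nn bp 1 \<Longrightarrow> j \<le> nn bp 2 \<Longrightarrow> k \<le> nn bp 3 \<Longrightarrow>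
        Ptilde_inv bp (gpt bp i j k) (Ep' t i j k) =
          spatial_rhs bp (Ep t) i j k
          + sat_plus bm bp (\<lambda>j k. sat_val 1 (R j k) (fault_normal bm j k) (Zp j k) (Gp t j k)) i j k
          + Tp t i j k"
    and other_faces_q: "\<And>t. t \<in> I \<Longrightarrow>
        face_term bm 1 0 (Em t) = 0 \<and> face_term bp 1 (nn bp 1) (Ep t) = 0"
    and other_faces_rs: "\<And>t \<xi>. t \<in> I \<Longrightarrow> \<xi> \<in> {2, 3} \<Longrightarrow>
        face_term bm \<xi> 0 (Em t) = 0 \<and> face_term bm \<xi> (nn bm \<xi>) (Em t) = 0 \<and>
        face_term bp \<xi> 0 (Ep t) = 0 \<and> face_term bp \<xi> (nn bp \<xi>) (Ep t) = 0"
  shows "\<forall>t\<in>I.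
    let BT = - (F_luc bm (Gm t) Zm + F_luc bm (Gp t) Zp + IT_s bm \<alpha> (wm t) (wp t)) in
      (\<exists>D. ((\<lambda>\<tau>. (hp_norm2 bm bp (Em \<tau>) (Ep \<tau>))\<^sup>2) has_real_derivative D) (at t within I) \<and>
         D + BT \<le> hp_norm2 bm bp (Em t) (Ep t) * hpinv_norm2 bm bp (Tm t) (Tp t)) \<and>
      BT \<ge> 0 \<and>
      F_luc bm (Gm t) Zm \<le> 0 \<and> F_luc bm (Gp t) Zp \<le> 0 \<and> IT_s bm \<alpha> (wm t) (wp t) \<le> 0"
proof (intro ballI)
  fix t assume t: "t \<in> I"
  let ?BT = "- (F_luc bm (Gm t) Zm + F_luc bm (Gp t) Zp + IT_s bm \<alpha> (wm t) (wp t))"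
  let ?N = "nn bm 1"
  let ?n = "fault_normal bm"
  let ?Sm = "\<lambda>j k. sat_val (-1) (R j k) (?n j k) (Zm j k) (Gm t j k)"
  let ?Sp = "\<lambda>j k. sat_val 1 (R j k) (?n j k) (Zp j k) (Gp t j k)"
  define D where "D = inner_H bm (Em t) (\<lambda>i j k. Ptilde_inv bm (gpt bm i j k) (Em' t i j k))
    + inner_H bp (Ep t) (\<lambda>i j k. Ptilde_inv bp (gpt bp i j k) (Ep' t i j k))"

  \<comment> \<open>The squared root can be removed at every time, as the energies are nonnegative
    for all grid functions.\<close>
  have "(\<lambda>\<tau>. (hp_norm2 bm bp (Em \<tau>) (Ep \<tau>))\<^sup>2) = (\<lambda>\<tau>. hp_sq bm (Em \<tau>) + hp_sq bp (Ep \<tau>))"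
    by (simp add: hp_norm2_def hp_sq_nonneg blocks)
  then have deriv: "((\<lambda>\<tau>. (hp_norm2 bm bp (Em \<tau>) (Ep \<tau>))\<^sup>2) has_real_derivative D) (at t within I)"
    using DERIV_add[OF hp_sq_has_derivative[OF blocks(1) diff_m[OF t]]
        hp_sq_has_derivative[OF blocks(2) diff_p[OF t]]]
    by (simp add: D_def)

  have rate_m: "inner_H bm (Em t) (\<lambda>i j k. Ptilde_inv bm (gpt bm i j k) (Em' t i j k))
      = inner_H bm (Em t) (spatial_rhs bm (Em t)) + inner_H bm (Em t) (sat_minus bm ?Sm)
        + inner_H bm (Em t) (Tm t)"
    unfolding inner_H_eq grid_sum_add[symmetric]
    by (intro grid_sum_cong) (simp add: error_m[OF t] inner_add_right)
  have rate_p: "inner_H bp (Ep t) (\<lambda>i j k. Ptilde_inv bp (gpt bp i j k) (Ep' t i j k))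
      = inner_H bp (Ep t) (spatial_rhs bp (Ep t)) + inner_H bp (Ep t) (sat_plus bm bp ?Sp)
        + inner_H bp (Ep t) (Tp t)"
    unfolding inner_H_eq grid_sum_add[symmetric]
    by (intro grid_sum_cong) (simp add: error_p[OF t] inner_add_right)

  \<comment> \<open>Only the fault face survives: the upper end of direction \<open>q\<close> in the
    minus block and the lower end in the plus block, hence the opposite signs in
    \<open>vol_m\<close> and \<open>vol_p\<close>.\<close>
  have vol_m: "inner_H bm (Em t) (spatial_rhs bm (Em t)) = fault_int bm (\<lambda>j k. evm t j k \<bullet> eTm t j k)"
    using other_faces_q[OF t] other_faces_rs[OF t]
    by (simp add: inner_H_spatial_rhs[OF dp_sbp_block[OF blocks(1)]] sum_3
        face_term_minus[OF frame rotation] evm eTm)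
  have vol_p: "inner_H bp (Ep t) (spatial_rhs bp (Ep t)) = - fault_int bm (\<lambda>j k. evp t j k \<bullet> eTp t j k)"
    using other_faces_q[OF t] other_faces_rs[OF t]
    by (simp add: inner_H_spatial_rhs[OF dp_sbp_block[OF blocks(2)]] sum_3
        face_term_plus[OF blocks frame rotation] evp eTp)
  have sat_m: "inner_H bm (Em t) (sat_minus bm ?Sm) = - fault_int bm (\<lambda>j k.
      evm t j k \<bullet> Gm t j k + eTm t j k \<bullet> (\<chi> c. Gm t j k $ c / Zm j k $ c))"
    by (simp add: inner_H_sat_minus[OF blocks(1)] inner_sat_val evm eTm)
  have sat_p: "inner_H bp (Ep t) (sat_plus bm bp ?Sp) = - fault_int bm (\<lambda>j k.
      evp t j k \<bullet> Gp t j k - eTp t j k \<bullet> (\<chi> c. Gp t j k $ c / Zp j k $ c))"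
    by (simp add: inner_H_sat_plus[OF blocks(2,3)] inner_sat_val evp eTp)

  \<comment> \<open>All four contributions are collected under one fault integral, since the hat
    conditions couple the two sides point by point.\<close>
  have "inner_H bm (Em t) (spatial_rhs bm (Em t)) + inner_H bm (Em t) (sat_minus bm ?Sm)
      + (inner_H bp (Ep t) (spatial_rhs bp (Ep t)) + inner_H bp (Ep t) (sat_plus bm bp ?Sp))
    = fault_int bm (\<lambda>j k.
        evm t j k \<bullet> eTm t j k
        - (evm t j k \<bullet> Gm t j k + eTm t j k \<bullet> (\<chi> c. Gm t j k $ c / Zm j k $ c))
        + (- (evp t j k \<bullet> eTp t j k)
        - (evp t j k \<bullet> Gp t j k - eTp t j k \<bullet> (\<chi> c. Gp t j k $ c / Zp j k $ c))))"
    by (simp only: vol_m vol_p sat_m sat_p fault_int_add fault_int_diff fault_int_minus)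
  also have "\<dots> = fault_int bm (\<lambda>j k.
        - (\<Sum>c\<in>UNIV. 1 / Zm j k $ c * \<bar>Gm t j k $ c\<bar>\<^sup>2)
        - (\<Sum>c\<in>UNIV. 1 / Zp j k $ c * \<bar>Gp t j k $ c\<bar>\<^sup>2)
        - \<alpha> * ((wp t j k $ 3 - wm t j k $ 3)\<^sup>2 + (wp t j k $ 2 - wm t j k $ 2)\<^sup>2))"
    by (intro fault_int_cong interface_power[OF hats[OF t] impedance Gm Gp])
  also have "\<dots> = - ?BT"
    by (simp add: F_luc_def IT_s_def fault_int_diff fault_int_minus)
  finally have "D + ?BT = inner_H bm (Em t) (Tm t) + inner_H bp (Ep t) (Tp t)"
    by (simp add: D_def rate_m rate_p)
  also have "\<dots> \<le> hp_norm2 bm bp (Em t) (Ep t) * hpinv_norm2 bm bp (Tm t) (Tp t)"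
  proof -
    \<comment> \<open>Cauchy-Schwarz over the two blocks, indexed by the booleans with
      \<open>True\<close> for the minus block.\<close>
    have "(\<Sum>s\<in>UNIV. if s then inner_H bm (Em t) (Tm t) else inner_H bp (Ep t) (Tp t))
      \<le> sqrt (\<Sum>s\<in>UNIV. if s then hp_sq bm (Em t) else hp_sq bp (Ep t))
        * sqrt (\<Sum>s\<in>UNIV. if s then hpinv_sq bm (Tm t) else hpinv_sq bp (Tp t))"
      by (rule sum_le_sqrt_mult_sqrt)
         (auto simp: hp_sq_nonneg hpinv_sq_nonneg inner_H_le blocks)
    then show ?thesis
      by (simp add: UNIV_bool hp_norm2_def hpinv_norm2_def add.commute)
  qed
  finally have energy: "D + ?BT \<le> hp_norm2 bm bp (Em t) (Ep t) * hpinv_norm2 bm bp (Tm t) (Tp t)" .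

  have signs: "F_luc bm (Gm t) Zm \<le> 0" "F_luc bm (Gp t) Zp \<le> 0" "IT_s bm \<alpha> (wm t) (wp t) \<le> 0"
    using impedance alpha by (auto intro: F_luc_nonpos IT_s_nonpos blocks)
  show "let BT = ?BT in
      (\<exists>D. ((\<lambda>\<tau>. (hp_norm2 bm bp (Em \<tau>) (Ep \<tau>))\<^sup>2) has_real_derivative D) (at t within I) \<and>
         D + BT \<le> hp_norm2 bm bp (Em t) (Ep t) * hpinv_norm2 bm bp (Tm t) (Tp t)) \<and>
      BT \<ge> 0 \<and>
      F_luc bm (Gm t) Zm \<le> 0 \<and> F_luc bm (Gp t) Zp \<le> 0 \<and> IT_s bm \<alpha> (wm t) (wp t) \<le> 0"
    using deriv energy signs unfolding Let_def by auto
qed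

end
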